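(* Let $F_\tau$ be the Gromov boundary of a supercritical Galton-Watson tree with bounded offspring distribution $X$, and let $m=\mathbb{E}(X)>1$. Let $\varepsilon>0$ and let $\phi$ be a dimension function such that $$\phi(x) > \frac{\log|\log x|}{|\log x|}\,(\varepsilon\log m)^{-1}$$ for all sufficiently small $x>0$ ($\log$ is the natural logarithm). Then, conditioned on non-extinction, almost surely $$\dim_{\mathrm A}^{\phi} F_\tau \le (1+\varepsilon)\,\dim_{\mathrm B} F_\tau .$$
   Context: Dimension function: a function $\phi$ with values in $(0,\infty)$ such that $x\mapsto\phi(x)$ and $x\mapsto\phi(x)|\log x|$ are both monotone on $(0,1)$. Generalised Assouad spectrum: for a metric space $F$ let $N_r(E)$ be the minimal number of balls of radius at most $r$ needed to cover $E$, and let $B(x,R)$ be the ball of radius $R$ centred at $x$. For a dimension function $\phi$, $\dim_{\mathrm A}^{\phi}F$ is the infimum of all $s$ for which there is $C>0$ such that for all $0<R<1$, with $r=R^{1+\phi(R)}$, one has $\sup_{x\in F}N_r(F\cap B(x,R))\le C(R/r)^s=C R^{-\phi(R)s}$. Galton-Watson tree: $X$ is a random variable taking values in $\{0,1,\dots,N\}$ for some integer $N$, with $\theta_j=\mathbb{P}\{X=j\}$. Starting from a single root, every node is given a random number of children with the law of $X$, independently of all other nodes. The process is supercritical: $m=\mathbb{E}(X)=\sum_{k}k\,\theta_k>1$. We condition on non-extinction, i.e. on the tree being infinite. The Gromov boundary $F_\tau$ is the set of infinite descending paths starting at the root, with metric $d(x,y)=2^{-|x\wedge y|}$, where $|x\wedge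 y|$ is the level of the least common ancestor (last common node) of $x$ and $y$. $\dim_{\mathrm B}$ is the box-counting dimension; it is known that almost surely (conditioned on non-extinction) $\dim_{\mathrm B}F_\tau=\dim_{\mathrm H}F_\tau=\log m/\log 2$. *)

theory Defs
  imports "HOL-Probability.Probability"
begin

definition dimension_function :: "(real \<Rightarrow> real) \<Rightarrow> bool" where
  "dimension_function \<phi> \<longleftrightarrow>
     (\<forall>x\<in>{0<..<1}. \<phi> x > 0) \<and>
     (mono_on {0<..<1} \<phi> \<or> antimono_on {0<..<1} \<phi>) \<and>
     (mono_on {0<..<1} (\<lambda>x. \<phi> x * \<bar>ln x\<bar>) \<or> antimono_on {0<..<1} (\<lambda>x. \<phi> x * \<bar>ln x\<bar>))"

definition ln_enat :: "enat \<Rightarrow> ereal" where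
  "ln_enat n = (case n of enat k \<Rightarrow> if k = 0 then -\<infinity> else ereal (ln (real k)) | \<infinity> \<Rightarrow> \<infinity>)"

context Metric_space
begin

text \<open>Balls are closed and centred in the space. The value is \<open>\<infinity>\<close> if \<open>E\<close> has no finite cover,
  since the infimum of the empty set in \<^typ>\<open>enat\<close> is \<open>\<infinity>\<close>.\<close>

definition covering_number :: "real \<Rightarrow> 'a set \<Rightarrow> enat" where
  "covering_number r E =
     Inf {enat (card \<B>) | \<B>. finite \<B> \<and> (\<forall>B\<in>\<B>. \<exists>c\<in>M. \<exists>\<rho>. 0 < \<rho> \<and> \<rho> \<le> r \<and> B = mcball c \<rho>) \<and>
        E \<subseteq> \<Union>\<B>}"

definition generalised_assouad_spectrum :: "(real \<Rightarrow> real) \<Rightarrow> ereal" where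
  "generalised_assouad_spectrum \<phi> =
     Inf {ereal s | s :: real. \<exists>C>0. \<forall>R\<in>{0<..<1}. let r = R powr (1 + \<phi> R) in
        (SUP x\<in>M. ereal_of_enat (covering_number r (mcball x R))) \<le> ereal (C * (R / r) powr s)}"

text \<open>As \<^const>\<open>Lim\<close> is a definite description, the value is meaningful only where the limit
  exists, that is, where the lower and upper box dimensions agree.\<close>

definition box_dim :: ereal where
  "box_dim = Lim (at_right 0) (\<lambda>r. ln_enat (covering_number r M) / ereal (- ln r))"

end

text \<open>Nodes carry Ulam-Harris labels: the root is \<open>[]\<close> and the children of \<open>v\<close> are
  \<open>v @ [i]\<close> with \<open>i < k v\<close>, where \<open>k v\<close> is the number of children of \<open>v\<close>. In a Galton-Watson
  process the offspring numbers are attached to all potential labels; those of labels outside the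
  tree are not used.\<close>

definition tree_of :: "(nat list \<Rightarrow> nat) \<Rightarrow> nat list set" where
  "tree_of k = {v. \<forall>i<length v. v ! i < k (take i v)}"

definition galton_watson :: "nat pmf \<Rightarrow> 'w measure \<Rightarrow> (nat list \<Rightarrow> 'w \<Rightarrow> nat) \<Rightarrow> bool" where
  "galton_watson p M K \<longleftrightarrow>
     prob_space M \<and>
     prob_space.indep_vars M (\<lambda>_. count_space UNIV) K UNIV \<and>
     (\<forall>v. distr M (count_space UNIV) (K v) = measure_pmf p)"

definition gw_tree :: "(nat list \<Rightarrow> 'w \<Rightarrow> nat) \<Rightarrow> 'w \<Rightarrow> nat list set" where
  "gw_tree K \<omega> = tree_of (\<lambda>v. K v \<omega>)"

text \<open>An infinite descending path from the root is the sequence \<open>x\<close> of the child indices chosen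
  along it; its node at level \<open>n\<close> is \<open>path_node x n\<close>.\<close>

definition path_node :: "(nat \<Rightarrow> nat) \<Rightarrow> nat \<Rightarrow> nat list" where
  "path_node x n = map x [0..<n]"

definition gromov_boundary :: "nat list set \<Rightarrow> (nat \<Rightarrow> nat) set" where
  "gromov_boundary T = {x. \<forall>n. path_node x n \<in> T}"

definition meet_level :: "(nat \<Rightarrow> nat) \<Rightarrow> (nat \<Rightarrow> nat) \<Rightarrow> nat" where
  "meet_level x y = (GREATEST n. path_node x n = path_node y n)"

definition boundary_dist :: "(nat \<Rightarrow> nat) \<Rightarrow> (nat \<Rightarrow> nat) \<Rightarrow> real" where
  "boundary_dist x y = (if x = y then 0 else (1 / 2) ^ meet_level x y)"

lemma path_node_eq_iff: "path_node x n = path_node y n \<longleftrightarrow> (\<forall>i<n. x i = y i)"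
  by (auto simp: path_node_def)

lemma le_meet_level_iff:
  assumes "x \<noteq> y"
  shows "n \<le> meet_level x y \<longleftrightarrow> (\<forall>i<n. x i = y i)"
proof -
  obtain j where j: "x j \<noteq> y j" using assms by auto
  have bound: "\<forall>n. path_node x n = path_node y n \<longrightarrow> n \<le> j"
    using j unfolding path_node_eq_iff by (meson not_le)
  have zero: "path_node x 0 = path_node y 0" by (simp add: path_node_def)
  have "path_node x (meet_level x y) = path_node y (meet_level x y)"
    unfolding meet_level_def by (rule GreatestI_nat[where P = "\<lambda>n. path_node x n = path_node y n", OF zero]) (use bound in blast)
  moreover have "n \<le> meet_level x y" if "path_node x n = path_node y n" for n
    unfolding meet_level_def by (rule Greatest_le_nat[where P = "\<lambda>n. path_node x n = path_node y n", OF that])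
      (use bound in blast)
  ultimately show ?thesis unfolding path_node_eq_iff by (meson less_le_trans)
qed

lemma Metric_space_boundary: "Metric_space A boundary_dist"
proof
  fix x y z :: "nat \<Rightarrow> nat"
  show "0 \<le> boundary_dist x y" by (simp add: boundary_dist_def)
  show "boundary_dist x y = boundary_dist y x"
    by (simp add: boundary_dist_def meet_level_def eq_commute)
  show "boundary_dist x y = 0 \<longleftrightarrow> x = y" by (simp add: boundary_dist_def)
  show "boundary_dist x z \<le> boundary_dist x y + boundary_dist y z"
  proof (cases "x = y \<or> y = z \<or> x = z")
    case True
    then show ?thesis by (auto simp: boundary_dist_def)
  next
    case False
    then have ne: "x \<noteq> y" "y \<noteq> z" "x \<noteq> z" by auto
    have "min (meet_level x y) (meet_level y z) \<le> meet_level x z"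
      using le_meet_level_iff[OF ne(1), of "meet_level x y"]
        le_meet_level_iff[OF ne(2), of "meet_level y z"]
      unfolding le_meet_level_iff[OF ne(3)] by simp
    then have "(1/2::real) ^ meet_level x z \<le> (1/2) ^ min (meet_level x y) (meet_level y z)"
      by (intro power_decreasing) auto
    also have "\<dots> \<le> (1/2) ^ meet_level x y + (1/2) ^ meet_level y z"
      by (simp add: min_def)
    finally show ?thesis using ne by (simp add: boundary_dist_def)
  qed
qed

end

theory Submission
  imports Defs
begin

text \<open>
  A ball of radius \<open>R\<close> in the boundary is a cylinder over a node \<open>v\<close> at level \<open>j \<approx> log\<^sub>2 (1/R)\<close>, and
  covering it at scale \<open>r\<close> costs at most the size of the generation of \<open>v\<close> that is
  \<open>n \<approx> \<phi>(R) log\<^sub>2 (1/R)\<close> levels below. Bounded offspring makes \<open>Z\<^sub>n / m\<^sup>n\<close> have uniformly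
  bounded exponential moments, so a generation exceeds \<open>m\<^bsup>(1+\<epsilon>')n\<^esup>\<close> with probability at most
  \<open>exp (1 - c m\<^bsup>\<epsilon>'n\<^esup>)\<close>. The threshold on \<open>\<phi>\<close> says that \<open>j = O(m\<^bsup>\<epsilon>n\<^esup>)\<close>; for \<open>\<epsilon>' > \<epsilon>\<close>
  this beats the \<open>N\<^sup>j\<close> possible nodes, and Borel-Cantelli applies.

  For the box dimension a lower bound on the number \<open>Y\<^sub>n\<close> of nodes with infinite progeny is also needed.
  With \<open>f\<close> the offspring generating function and \<open>q\<close> the extinction probability,
  \<open>E(s\<^bsup>Y\<^esup>; survival) = f\<^sup>n(q + (1 - q) s) - q\<close> for \<open>Y = Y\<^sub>n\<close>. One step of \<open>f\<close> is dominated by a map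
  conjugate to multiplication by \<open>M < m\<close>, whose iterates are explicit; this makes
  \<open>P(survival, Y\<^sub>n < M'\<^sup>n)\<close> summable for every \<open>M' < M\<close>.
\<close>

subsection \<open>The branching property\<close>

text \<open>The law of the whole family of offspring numbers. Almost sure statements are proved on
  this canonical space and pulled back to \<open>M\<close> at the end.\<close>

definition gw_measure :: "nat pmf \<Rightarrow> (nat list \<Rightarrow> nat) measure" where
  "gw_measure p = PiM UNIV (\<lambda>_. measure_pmf p)"

lemma prob_space_gw_measure: "prob_space (gw_measure p)"
  unfolding gw_measure_def by (intro prob_space_PiM prob_space_measure_pmf)

lemma space_gw_measure [simp]: "space (gw_measure p) = UNIV"
  by (simp add: gw_measure_def space_PiM)

lemma sets_gw_measure: "sets (gw_measure p) = sets (PiM UNIV (\<lambda>_. count_space UNIV))"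
  unfolding gw_measure_def by (intro sets_PiM_cong) simp_all

lemma measurable_offspring [measurable]: "(\<lambda>k. k v) \<in> gw_measure p \<rightarrow>\<^sub>M count_space UNIV"
  unfolding measurable_cong_sets[OF sets_gw_measure refl] by measurable

lemma measurable_subtree [measurable]: "(\<lambda>k u. k (f u)) \<in> gw_measure p \<rightarrow>\<^sub>M gw_measure p"
  unfolding measurable_cong_sets[OF sets_gw_measure sets_gw_measure]
  by (rule measurable_PiM_single') (auto simp: space_PiM)

lemma distr_offspring: "distr (gw_measure p) (count_space UNIV) (\<lambda>k. k v) = measure_pmf p"
proof -
  have "distr (gw_measure p) (measure_pmf p) (\<lambda>k. k v) = measure_pmf p"
    unfolding gw_measure_def
    by (rule distr_PiM_component) (auto simp: prob_space_measure_pmf)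
  then show ?thesis by (metis distr_cong sets_measure_pmf_count_space)
qed

lemma distr_subtree:
  assumes "inj f"
  shows "distr (gw_measure p) (gw_measure p) (\<lambda>k u. k (f u)) = gw_measure p"
  using distr_PiM_reindex[of UNIV "\<lambda>_. measure_pmf p" f UNIV] assms
  by (simp add: gw_measure_def prob_space_measure_pmf restrict_UNIV)

lemma indep_offspring: "prob_space.indep_vars (gw_measure p) (\<lambda>_. measure_pmf p) (\<lambda>v k. k v) UNIV"
proof -
  interpret prob_space "gw_measure p" by (rule prob_space_gw_measure)
  have rv: "(\<lambda>k. k v) \<in> gw_measure p \<rightarrow>\<^sub>M measure_pmf p" for v
    using measurable_offspring by simp
  have "distr (gw_measure p) (PiM UNIV (\<lambda>_. measure_pmf p)) (\<lambda>x. \<lambda>i\<in>UNIV. x i) = gw_measure p"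
    by (simp add: gw_measure_def distr_id2 restrict_UNIV)
  moreover have "PiM UNIV (\<lambda>v. distr (gw_measure p) (measure_pmf p) (\<lambda>k. k v)) = gw_measure p"
  proof -
    have "distr (gw_measure p) (measure_pmf p) (\<lambda>k. k v) = measure_pmf p" for v
      unfolding gw_measure_def by (rule distr_PiM_component) (auto simp: prob_space_measure_pmf)
    then show ?thesis by (simp add: gw_measure_def)
  qed
  ultimately show ?thesis
    by (subst indep_vars_iff_distr_eq_PiM) (use rv in auto)
qed

text \<open>Independence with prescribed marginals means that the joint law is the product measure,
  so every Galton-Watson family is distributed like the canonical one.\<close>

lemma distr_galton_watson:
  assumes "galton_watson p M K"
  shows "(\<lambda>\<omega> v. K v \<omega>) \<in> M \<rightarrow>\<^sub>M gw_measure p"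
    and "distr M (gw_measure p) (\<lambda>\<omega> v. K v \<omega>) = gw_measure p"
proof -
  interpret prob_space M using assms by (simp add: galton_watson_def)
  have ind: "indep_vars (\<lambda>_. count_space UNIV) K UNIV"
    and dis: "distr M (count_space UNIV) (K v) = measure_pmf p" for v
    using assms by (auto simp: galton_watson_def)
  have rv: "K v \<in> M \<rightarrow>\<^sub>M count_space UNIV" for v
    using ind unfolding indep_vars_def by blast
  have eq: "distr M (PiM UNIV (\<lambda>_. count_space UNIV)) (\<lambda>x. \<lambda>i\<in>UNIV. K i x) = gw_measure p"
    using indep_vars_iff_distr_eq_PiM[THEN iffD1, OF UNIV_not_empty rv ind]
    by (simp only: dis gw_measure_def)
  show "(\<lambda>\<omega> v. K v \<omega>) \<in> M \<rightarrow>\<^sub>M gw_measure p"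
    unfolding measurable_cong_sets[OF refl sets_gw_measure]
    by (rule measurable_PiM_single'[OF rv]) (simp add: PiE_UNIV_domain)
  show "distr M (gw_measure p) (\<lambda>\<omega> v. K v \<omega>) = gw_measure p"
    using eq distr_cong[of M M "gw_measure p" "PiM UNIV (\<lambda>_. count_space UNIV)"
        "\<lambda>\<omega> v. K v \<omega>" "\<lambda>\<omega> v. K v \<omega>"]
    by (simp add: sets_gw_measure restrict_UNIV)
qed

text \<open>The branching property in one identity: the offspring number of the root and the
  families on its subtrees use disjoint sets of coordinates, hence are independent, and each subtree
  has the law of the whole. The recursion for exponential moments and the equation for the
  extinction probability both come from it.\<close>

lemma nn_integral_branching:
  assumes H [measurable]: "H \<in> borel_measurable (gw_measure p)"
  shows "(\<integral>\<^sup>+k. (\<Prod>i<k []. H (\<lambda>u. k (i # u))) \<partial>gw_measure p)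
       = (\<integral>\<^sup>+j. (\<integral>\<^sup>+k. H k \<partial>gw_measure p) ^ j \<partial>measure_pmf p)"
proof -
  interpret prob_space "gw_measure p" by (rule prob_space_gw_measure)
  have fixed: "(\<integral>\<^sup>+k. indicator {j} (k []) * (\<Prod>i<j. H (\<lambda>u. k (i # u))) \<partial>gw_measure p)
       = pmf p j * (\<integral>\<^sup>+k. H k \<partial>gw_measure p) ^ j" for j
  proof -
    \<comment> \<open>Block \<open>0\<close> is the root label, block \<open>Suc i\<close> consists
      of all labels starting with \<open>i\<close>.\<close>
    define J where "J n = (case n of 0 \<Rightarrow> {[]} | Suc i \<Rightarrow> range (Cons i))" for n :: nat
    define X where "X n = (case n of 0 \<Rightarrow> (\<lambda>k. indicator {j} (k []))
       | Suc i \<Rightarrow> (\<lambda>k. H (\<lambda>u. k (i # u))))" for n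
    have disj: "disjoint_family_on J {..<Suc j}"
      by (auto simp: disjoint_family_on_def J_def split: nat.splits)
    have ind: "indep_vars (\<lambda>n. PiM (J n) (\<lambda>_. measure_pmf p)) (\<lambda>n k. restrict (\<lambda>v. k v) (J n)) {..<Suc j}"
      by (rule indep_vars_restrict[OF indep_offspring _ disj]) auto
    have *: "(\<lambda>k u. k (i # u)) \<in> PiM (range (Cons i)) (\<lambda>_. measure_pmf p) \<rightarrow>\<^sub>M gw_measure p" for i :: nat
      unfolding gw_measure_def
      by (rule measurable_PiM_single'[OF measurable_component_singleton]) (simp_all add: PiE_UNIV_domain space_PiM)
    have Xm: "X n \<in> borel_measurable (PiM (J n) (\<lambda>_. measure_pmf p))" for n
    proof (cases n)
      case 0
      have "(\<lambda>k. k []) \<in> PiM {[]} (\<lambda>_. measure_pmf p) \<rightarrow>\<^sub>M measure_pmf p"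
        by (rule measurable_component_singleton) simp
      then have "(\<lambda>k. indicator {j} (k []) :: ennreal) \<in> borel_measurable (PiM {[]} (\<lambda>_. measure_pmf p))"
        by (rule measurable_compose) simp
      then show ?thesis by (simp only: 0 X_def J_def nat.case)
    next
      case (Suc i)
      have "(\<lambda>k. H (\<lambda>u. k (i # u))) \<in> borel_measurable (PiM (range (Cons i)) (\<lambda>_. measure_pmf p))"
        by (rule measurable_compose[OF * H])
      then show ?thesis by (simp only: Suc X_def J_def nat.case)
    qed
    have "indep_vars (\<lambda>_. borel) (\<lambda>n k. X n (restrict (\<lambda>v. k v) (J n))) {..<Suc j}"
      by (rule indep_vars_compose2[OF ind]) (rule Xm)
    also have "(\<lambda>n k. X n (restrict (\<lambda>v. k v) (J n))) = X"
    proof (intro ext)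
      fix n k show "X n (restrict (\<lambda>v. k v) (J n)) = X n k"
        by (cases n) (simp_all add: X_def J_def)
    qed
    finally have ind': "indep_vars (\<lambda>_. borel) X {..<Suc j}" .
    have "(\<integral>\<^sup>+k. (\<Prod>n<Suc j. X n k) \<partial>gw_measure p) = (\<Prod>n<Suc j. \<integral>\<^sup>+k. X n k \<partial>gw_measure p)"
      by (rule indep_vars_nn_integral[OF _ ind']) auto
    moreover have "(\<integral>\<^sup>+k. X 0 k \<partial>gw_measure p) = pmf p j"
    proof -
      have "(\<integral>\<^sup>+k. X 0 k \<partial>gw_measure p) = (\<integral>\<^sup>+x. indicator {j} x \<partial>distr (gw_measure p) (count_space UNIV) (\<lambda>k. k []))"
        by (subst nn_integral_distr) (auto simp: X_def)
      then show ?thesis by (simp add: distr_offspring emeasure_pmf_single)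
    qed
    moreover have "(\<integral>\<^sup>+k. X (Suc i) k \<partial>gw_measure p) = (\<integral>\<^sup>+k. H k \<partial>gw_measure p)" for i
    proof -
      have "(\<integral>\<^sup>+k. X (Suc i) k \<partial>gw_measure p) = (\<integral>\<^sup>+k. H k \<partial>distr (gw_measure p) (gw_measure p) (\<lambda>k u. k (i # u)))"
        by (subst nn_integral_distr) (auto simp: X_def)
      then show ?thesis by (simp add: distr_subtree)
    qed
    ultimately show ?thesis
      unfolding prod.lessThan_Suc_shift by (simp add: X_def)
  qed
  have Hm [measurable]: "(\<lambda>k. H (\<lambda>u. k (i # u))) \<in> borel_measurable (gw_measure p)" for i
    by (rule measurable_compose[OF measurable_subtree H])
  have summand [measurable]: "(\<lambda>k. indicator {j} (k []) * (\<Prod>i<j. H (\<lambda>u. k (i # u))))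
      \<in> borel_measurable (gw_measure p)" for j
  proof -
    have "(\<lambda>k. indicator {j} (k []) :: ennreal) \<in> borel_measurable (gw_measure p)"
      by (rule measurable_compose[OF measurable_offspring]) simp
    moreover have "(\<lambda>k. \<Prod>i<j. H (\<lambda>u. k (i # u))) \<in> borel_measurable (gw_measure p)"
      by (rule borel_measurable_prod_ennreal) (rule Hm)
    ultimately show ?thesis by (rule borel_measurable_times_ennreal)
  qed
  \<comment> \<open>The number of factors is random; splitting by the value \<open>j\<close> of
    \<open>k []\<close> leaves a fixed number of factors in each summand.\<close>
  have "(\<Prod>i<k []. H (\<lambda>u. k (i # u))) = (\<Sum>j. indicator {j} (k []) * (\<Prod>i<j. H (\<lambda>u. k (i # u))))" for k
    by (subst suminf_finite[of "{k []}"]) (auto simp: indicator_def)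
  then have "(\<integral>\<^sup>+k. (\<Prod>i<k []. H (\<lambda>u. k (i # u))) \<partial>gw_measure p)
     = (\<integral>\<^sup>+k. (\<Sum>j. indicator {j} (k []) * (\<Prod>i<j. H (\<lambda>u. k (i # u)))) \<partial>gw_measure p)"
    by simp
  also have "\<dots> = (\<Sum>j. pmf p j * (\<integral>\<^sup>+k. H k \<partial>gw_measure p) ^ j)"
    by (subst nn_integral_suminf[OF summand]) (simp only: fixed)
  also have "\<dots> = (\<integral>\<^sup>+j. (\<integral>\<^sup>+k. H k \<partial>gw_measure p) ^ j \<partial>measure_pmf p)"
    by (simp add: nn_integral_measure_pmf nn_integral_count_space_nat)
  finally show ?thesis .
qed

subsection \<open>Trees, their boundaries and covering numbers\<close>

text \<open>The recursion peels off the root rather than the last generation, to match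
  \<open>nn_integral_branching\<close>. The function \<open>h\<close> evaluates the subtrees rooted
  at level \<open>n\<close>; the two instances below give the \<open>Z\<close> and \<open>Y\<close>
  of the overview.\<close>

primrec desc_sum :: "((nat list \<Rightarrow> nat) \<Rightarrow> nat) \<Rightarrow> nat \<Rightarrow> (nat list \<Rightarrow> nat) \<Rightarrow> nat" where
  "desc_sum h 0 k = h k"
| "desc_sum h (Suc n) k = (\<Sum>i<k []. desc_sum h n (\<lambda>u. k (i # u)))"

abbreviation generation_size :: "nat \<Rightarrow> (nat list \<Rightarrow> nat) \<Rightarrow> nat" where
  "generation_size \<equiv> desc_sum (\<lambda>_. 1)"

abbreviation surviving_size :: "nat \<Rightarrow> (nat list \<Rightarrow> nat) \<Rightarrow> nat" where
  "surviving_size \<equiv> desc_sum (\<lambda>k. if infinite (tree_of k) then 1 else 0)"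

definition level :: "nat \<Rightarrow> (nat list \<Rightarrow> nat) \<Rightarrow> nat list set" where
  "level n k = {w \<in> tree_of k. length w = n}"

lemma Nil_in_tree_of [simp]: "[] \<in> tree_of k"
  by (simp add: tree_of_def)

lemma Cons_in_tree_of_iff: "i # w \<in> tree_of k \<longleftrightarrow> i < k [] \<and> w \<in> tree_of (\<lambda>u. k (i # u))"
proof -
  have "i # w \<in> tree_of k \<longleftrightarrow> (\<forall>j<Suc (length w). (i # w) ! j < k (take j (i # w)))"
    by (simp add: tree_of_def)
  also have "\<dots> \<longleftrightarrow> i < k [] \<and> (\<forall>j<length w. w ! j < k (i # take j w))"
    unfolding All_less_Suc2 by simp
  finally show ?thesis by (simp add: tree_of_def)
qed

lemma append_in_tree_of_iff:
  "v @ w \<in> tree_of k \<longleftrightarrow> v \<in> tree_of k \<and> w \<in> tree_of (\<lambda>u. k (v @ u))"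
  by (induction v arbitrary: k) (auto simp: Cons_in_tree_of_iff)

lemma tree_of_unfold: "tree_of k = insert [] (\<Union>i<k []. (#) i ` tree_of (\<lambda>u. k (i # u)))"
proof (intro set_eqI)
  fix w show "w \<in> tree_of k \<longleftrightarrow> w \<in> insert [] (\<Union>i<k []. (#) i ` tree_of (\<lambda>u. k (i # u)))"
    by (cases w) (auto simp: Cons_in_tree_of_iff)
qed

lemma finite_tree_of_iff: "finite (tree_of k) \<longleftrightarrow> (\<forall>i<k []. finite (tree_of (\<lambda>u. k (i # u))))"
  by (subst tree_of_unfold) (auto simp: finite_image_iff)

lemma level_Suc: "level (Suc n) k = (\<Union>i<k []. (#) i ` level n (\<lambda>u. k (i # u)))"
  unfolding level_def by (subst tree_of_unfold) auto

lemma finite_level [simp]: "finite (level n k)"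
proof (induction n arbitrary: k)
  case 0
  then show ?case by (simp add: level_def)
qed (simp add: level_Suc)

lemma desc_sum_eq_sum_level: "desc_sum h n k = (\<Sum>w\<in>level n k. h (\<lambda>u. k (w @ u)))"
proof (induction n arbitrary: k)
  case 0
  have "level 0 k = {[]}" by (auto simp: level_def)
  then show ?case by simp
next
  case (Suc n)
  have "(\<Sum>w\<in>level (Suc n) k. h (\<lambda>u. k (w @ u)))
      = (\<Sum>i<k []. \<Sum>w\<in>(#) i ` level n (\<lambda>u. k (i # u)). h (\<lambda>u. k (w @ u)))"
    unfolding level_Suc by (rule sum.UNION_disjoint) auto
  also have "\<dots> = (\<Sum>i<k []. desc_sum h n (\<lambda>u. k (i # u)))"
    by (intro sum.cong refl) (simp add: sum.reindex Suc.IH)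
  finally show ?case by simp
qed

lemma generation_size_eq_card: "generation_size n k = card (level n k)"
  by (simp add: desc_sum_eq_sum_level)

lemma surviving_size_eq_card:
  "surviving_size n k = card {w \<in> level n k. infinite (tree_of (\<lambda>u. k (w @ u)))}"
  by (simp add: desc_sum_eq_sum_level sum.If_cases Int_def)

lemma surviving_size_eq_0_iff: "surviving_size n k = 0 \<longleftrightarrow> finite (tree_of k)"
proof (induction n arbitrary: k)
  case (Suc n)
  then show ?case by (simp add: finite_tree_of_iff[of k] Ball_def)
qed simp

lemma generation_size_le:
  assumes "\<And>v. k v \<le> N"
  shows "generation_size n k \<le> N ^ n"
  using assms
proof (induction n arbitrary: k)
  case (Suc n)
  have "generation_size (Suc n) k \<le> (\<Sum>i<k []. N ^ n)"
    unfolding desc_sum.simps by (intro sum_mono Suc.IH) (rule Suc.prems)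
  also have "\<dots> \<le> N * N ^ n" using Suc.prems by simp
  finally show ?case by simp
qed simp

lemma path_node_Suc: "path_node x (Suc n) = path_node x n @ [x n]"
  by (simp add: path_node_def)

lemma length_path_node [simp]: "length (path_node x n) = n"
  by (simp add: path_node_def)

lemma path_node_add: "path_node x (j + n) = path_node x j @ path_node (\<lambda>i. x (j + i)) n"
  by (rule nth_equalityI) (auto simp: path_node_def nth_append)

text \<open>Koenig's lemma: offspring numbers are finite, so a node with infinite progeny has a
  child with infinite progeny, and following such children never stops.\<close>

lemma exists_infinite_path:
  assumes "infinite (tree_of k)"
  shows "\<exists>x. x \<in> gromov_boundary (tree_of k)"
proof -
  have "\<exists>f. \<forall>n. (f n \<in> level n k \<and> infinite (tree_of (\<lambda>u. k (f n @ u)))) \<and> (\<exists>i. f (Suc n) = f n @ [i])"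
  proof (rule dependent_nat_choice)
    show "\<exists>v. v \<in> level 0 k \<and> infinite (tree_of (\<lambda>u. k (v @ u)))"
      using assms by (intro exI[of _ "[]"]) (simp add: level_def)
  next
    fix v n assume v: "v \<in> level n k \<and> infinite (tree_of (\<lambda>u. k (v @ u)))"
    then obtain i where "i < k v" "infinite (tree_of (\<lambda>u. k (v @ i # u)))"
      using finite_tree_of_iff[of "\<lambda>u. k (v @ u)"] by auto
    with v show "\<exists>w. (w \<in> level (Suc n) k \<and> infinite (tree_of (\<lambda>u. k (w @ u)))) \<and> (\<exists>i. w = v @ [i])"
      by (intro exI[of _ "v @ [i]"]) (auto simp: level_def append_in_tree_of_iff Cons_in_tree_of_iff)
  qed
  then obtain f where f: "\<And>n. f n \<in> level n k" "\<And>n. \<exists>i. f (Suc n) = f n @ [i]" by blast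
  have "path_node (\<lambda>n. last (f (Suc n))) n = f n" for n
  proof (induction n)
    case 0
    then show ?case using f(1)[of 0] by (simp add: level_def path_node_def)
  next
    case (Suc n)
    then show ?case using f(2)[of n] by (auto simp: path_node_Suc)
  qed
  then have "(\<lambda>n. last (f (Suc n))) \<in> gromov_boundary (tree_of k)"
    using f(1) by (simp add: gromov_boundary_def level_def)
  then show ?thesis by blast
qed

lemma exists_infinite_path_through:
  assumes w: "w \<in> level n k" and inf: "infinite (tree_of (\<lambda>u. k (w @ u)))"
  shows "\<exists>x\<in>gromov_boundary (tree_of k). path_node x n = w"
proof -
  obtain y where y: "y \<in> gromov_boundary (tree_of (\<lambda>u. k (w @ u)))"
    using exists_infinite_path[OF inf] by blast
  have len: "length w = n" and wt: "w \<in> tree_of k" using w by (auto simp: level_def)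
  define x where "x i = (if i < n then w ! i else y (i - n))" for i
  have "path_node x n = w"
    by (rule nth_equalityI) (auto simp: path_node_def x_def len)
  moreover have *: "path_node x (n + l) = w @ path_node y l" for l
    unfolding path_node_add \<open>path_node x n = w\<close> by (simp add: x_def path_node_def)
  \<comment> \<open>Membership at level \<open>l\<close> is read off from level
    \<open>n + l\<close>, since prefixes of tree nodes are tree nodes.\<close>
  have "path_node x l \<in> tree_of k" for l
  proof -
    have "path_node x (n + l) \<in> tree_of k"
      unfolding * append_in_tree_of_iff using y wt by (auto simp: gromov_boundary_def)
    then show ?thesis
      unfolding add.commute[of n] path_node_add append_in_tree_of_iff by simp
  qed
  ultimately show ?thesis by (auto simp: gromov_boundary_def)
qed

lemma path_nodes_subset_level:
  "(\<lambda>x. path_node x n) ` gromov_boundary (tree_of k) \<subseteq> level n k"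
  by (auto simp: gromov_boundary_def level_def)

text \<open>Source of the lower bound on box counts: a node with infinite progeny lies on some
  boundary path.\<close>

lemma surviving_size_le_card_path_nodes:
  "surviving_size n k \<le> card ((\<lambda>x. path_node x n) ` gromov_boundary (tree_of k))"
proof -
  have "{w \<in> level n k. infinite (tree_of (\<lambda>u. k (w @ u)))}
      \<subseteq> (\<lambda>x. path_node x n) ` gromov_boundary (tree_of k)"
    using exists_infinite_path_through by blast
  then show ?thesis
    unfolding surviving_size_eq_card
    by (rule card_mono[OF finite_subset[OF path_nodes_subset_level finite_level]])
qed

text \<open>Paths through \<open>v\<close> are bounded by all descendants \<open>n\<close> levels
  below it, including those whose lines die out, so coverings can be controlled by generation
  sizes.\<close>

lemma card_path_nodes_below_le:
  "card ((\<lambda>x. path_node x (j + n)) ` {x \<in> gromov_boundary (tree_of k). path_node x j = v})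
    \<le> generation_size n (\<lambda>u. k (v @ u))"
proof -
  have "(\<lambda>x. path_node x (j + n)) ` {x \<in> gromov_boundary (tree_of k). path_node x j = v}
     \<subseteq> (@) v ` level n (\<lambda>u. k (v @ u))"
  proof (clarsimp)
    fix x assume "x \<in> gromov_boundary (tree_of k)" and v: "v = path_node x j"
    then have "path_node x (j + n) \<in> tree_of k" by (simp add: gromov_boundary_def)
    then show "path_node x (j + n) \<in> (@) (path_node x j) ` level n (\<lambda>u. k (path_node x j @ u))"
      unfolding path_node_add append_in_tree_of_iff by (simp add: level_def)
  qed
  then have "card ((\<lambda>x. path_node x (j + n)) ` {x \<in> gromov_boundary (tree_of k). path_node x j = v})
     \<le> card ((@) v ` level n (\<lambda>u. k (v @ u)))"
    by (intro card_mono) auto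
  also have "\<dots> \<le> card (level n (\<lambda>u. k (v @ u)))" by (rule card_image_le) simp
  finally show ?thesis unfolding generation_size_eq_card .
qed

section \<open>Scales, cylinders and covering numbers\<close>

definition scale_level :: "real \<Rightarrow> nat" where
  "scale_level r = nat \<lceil>- log 2 r\<rceil>"

lemma scale_level_le_iff: "scale_level r \<le> n \<longleftrightarrow> - log 2 r \<le> real n"
  unfolding scale_level_def by (simp add: nat_le_iff ceiling_le_iff)

text \<open>Hence \<open>scale_level r\<close> is the first level \<open>n\<close> with
  \<open>(1 / 2) ^ n \<le> r\<close>; the truncation by \<open>nat\<close> makes it \<open>0\<close>
  for \<open>r \<ge> 1\<close>.\<close>

lemma half_power_le_iff:
  assumes "r > 0"
  shows "(1 / 2 :: real) ^ n \<le> r \<longleftrightarrow> scale_level r \<le> n"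
proof -
  have "(1 / 2 :: real) ^ n = 2 powr (- real n)"
    by (simp add: powr_minus powr_realpow power_one_over divide_simps)
  also have "\<dots> \<le> r \<longleftrightarrow> - real n \<le> log 2 r"
    using assms by (simp add: le_log_iff)
  finally show ?thesis unfolding scale_level_le_iff by auto
qed

text \<open>In this ultrametric the closed balls of positive radius are exactly the cylinders, which
  turns metric statements into counting of nodes.\<close>

lemma boundary_dist_le_iff:
  assumes "r > 0"
  shows "boundary_dist x y \<le> r \<longleftrightarrow> path_node x (scale_level r) = path_node y (scale_level r)"
proof (cases "x = y")
  case True
  then show ?thesis using assms by (simp add: boundary_dist_def)
next
  case False
  then show ?thesis
    by (simp add: boundary_dist_def half_power_le_iff[OF assms] le_meet_level_iff path_node_eq_iff)
qed

text \<open>Balls of radius \<open>r\<close> around one point per cylinder cover \<open>E\<close>;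
  conversely a ball of radius at most \<open>r\<close> meets only one cylinder, so no cover can use
  fewer.\<close>

lemma covering_number_boundary:
  assumes r: "r > 0" and E: "E \<subseteq> F" and fin: "finite ((\<lambda>x. path_node x (scale_level r)) ` E)"
  shows "Metric_space.covering_number F boundary_dist r E
       = enat (card ((\<lambda>x. path_node x (scale_level r)) ` E))"
proof -
  interpret Metric_space F boundary_dist by (rule Metric_space_boundary)
  define P where "P = (\<lambda>x. path_node x (scale_level r))"
  have fin': "finite (P ` E)" using fin by (simp add: P_def)
  \<comment> \<open>One representative of \<open>E\<close> in each cylinder meeting it: a centre for
    the upper bound, a separated point for the lower one.\<close>
  obtain e where e: "\<And>w. w \<in> P ` E \<Longrightarrow> e w \<in> E \<and> P (e w) = w"
    by (metis (mono_tags, lifting) image_iff)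
  have "covering_number r E \<le> enat (card (P ` E))"
  proof -
    have "covering_number r E \<le> enat (card ((\<lambda>w. mcball (e w) r) ` P ` E))"
      unfolding covering_number_def
    proof (rule Inf_lower, rule CollectI,
        rule exI[of _ "(\<lambda>w. mcball (e w) r) ` P ` E"], intro conjI refl)
      show "finite ((\<lambda>w. mcball (e w) r) ` P ` E)" using fin' by simp
      show "\<forall>B\<in>(\<lambda>w. mcball (e w) r) ` P ` E. \<exists>c\<in>F. \<exists>\<rho>>0. \<rho> \<le> r \<and> B = mcball c \<rho>"
        using e E r by blast
      show "E \<subseteq> \<Union> ((\<lambda>w. mcball (e w) r) ` P ` E)"
      proof
        fix x assume x: "x \<in> E"
        then have "e (P x) \<in> E" "P (e (P x)) = P x" using e by auto
        then have "x \<in> mcball (e (P x)) r"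
          using x E boundary_dist_le_iff[OF r, of "e (P x)" x] by (auto simp: mcball_def P_def)
        then show "x \<in> \<Union> ((\<lambda>w. mcball (e w) r) ` P ` E)" using x by blast
      qed
    qed
    also have "\<dots> \<le> enat (card (P ` E))" using card_image_le[OF fin'] by simp
    finally show ?thesis .
  qed
  moreover have "enat (card (P ` E)) \<le> covering_number r E"
    unfolding covering_number_def
  proof (rule Inf_greatest, clarify)
    fix \<B> assume \<B>: "finite \<B>" "\<forall>B\<in>\<B>. \<exists>c\<in>F. \<exists>\<rho>>0. \<rho> \<le> r \<and> B = mcball c \<rho>" "E \<subseteq> \<Union> \<B>"
    have "\<forall>w\<in>P ` E. \<exists>B\<in>\<B>. e w \<in> B" using e \<B>(3) by blast
    then obtain b where b: "\<And>w. w \<in> P ` E \<Longrightarrow> b w \<in> \<B> \<and> e w \<in> b w" by metis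
    \<comment> \<open>All points of a ball of radius \<open>\<rho> \<le> r\<close> lie within
      \<open>r\<close> of its centre \<open>c\<close>, hence in the cylinder of \<open>c\<close>; so
      different representatives need different balls.\<close>
    have same: "P x = P y" if B: "B \<in> \<B>" "x \<in> B" "y \<in> B" for B x y
    proof -
      obtain c \<rho> where c: "\<rho> > 0" "\<rho> \<le> r" "B = mcball c \<rho>" using bspec[OF \<B>(2) B(1)] by metis
      have "P c = P z" if "z \<in> B" for z
      proof -
        have "boundary_dist c z \<le> r" using that c by (auto simp: mcball_def)
        then show ?thesis unfolding boundary_dist_le_iff[OF r] P_def .
      qed
      then show ?thesis using B by metis
    qed
    have "inj_on b (P ` E)"
      by (rule inj_onI) (metis b e same)
    then have "card (P ` E) \<le> card \<B>"
      using b \<B>(1) by (intro card_inj_on_le[of b]) auto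
    then show "enat (card (P ` E)) \<le> enat (card \<B>)" by simp
  qed
  ultimately show ?thesis unfolding P_def by (rule antisym)
qed

subsection \<open>Exponential moments of the generation sizes\<close>

lemma measurable_desc_sum [measurable]:
  assumes h: "h \<in> gw_measure p \<rightarrow>\<^sub>M count_space UNIV"
  shows "desc_sum h n \<in> gw_measure p \<rightarrow>\<^sub>M count_space UNIV"
proof (induction n)
  case 0
  have "desc_sum h 0 = h" by (simp add: fun_eq_iff)
  then show ?case using h by (simp only:)
next
  case (Suc n)
  have "(\<lambda>k. desc_sum h n (\<lambda>u. k (i # u))) \<in> gw_measure p \<rightarrow>\<^sub>M count_space UNIV" for i
    by (rule measurable_compose[OF measurable_subtree Suc.IH])
  then have "(\<lambda>k. \<Sum>i<j. desc_sum h n (\<lambda>u. k (i # u))) \<in> gw_measure p \<rightarrow>\<^sub>M count_space UNIV" for j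
    by (intro measurable_sum_nat)
  \<comment> \<open>The summation limit is itself random: measurability for each fixed limit
    \<open>j\<close> is glued over the countably many values of \<open>k []\<close>.\<close>
  then have "(\<lambda>k. \<Sum>i<k []. desc_sum h n (\<lambda>u. k (i # u))) \<in> gw_measure p \<rightarrow>\<^sub>M count_space UNIV"
    by (rule measurable_compose_countable[OF _ measurable_offspring])
  moreover have "desc_sum h (Suc n) = (\<lambda>k. \<Sum>i<k []. desc_sum h n (\<lambda>u. k (i # u)))"
    by (simp add: fun_eq_iff)
  ultimately show ?case by (simp only:)
qed

lemma measurable_finite_tree [measurable]: "Measurable.pred (gw_measure p) (\<lambda>k. finite (tree_of k))"
proof -
  \<comment> \<open>There are only countably many finite label sets \<open>A\<close>, so finiteness
    is a countable union of the events that no label outside \<open>A\<close> is in the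
    tree.\<close>
  have *: "finite (tree_of k) \<longleftrightarrow> (\<exists>A\<in>Collect finite. \<forall>v. v \<notin> A \<longrightarrow> \<not> (\<forall>i<length v. v ! i < k (take i v)))" for k
    by (auto simp: tree_of_def intro: finite_subset[of _ "_ :: nat list set"] exI)
       (metis (mono_tags, lifting) finite_subset mem_Collect_eq subsetI)
  have "countable (Collect finite :: nat list set set)" by (rule countable_Collect_finite)
  then show ?thesis unfolding * by measurable
qed

text \<open>The exponential turns the sum over subtrees into a product, to which the branching
  property applies.\<close>

lemma nn_integral_exp_desc_sum_Suc:
  fixes t :: real
  assumes h: "h \<in> gw_measure p \<rightarrow>\<^sub>M count_space UNIV"
  shows "(\<integral>\<^sup>+k. exp (t * desc_sum h (Suc n) k) \<partial>gw_measure p)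
       = (\<integral>\<^sup>+j. (\<integral>\<^sup>+k. exp (t * desc_sum h n k) \<partial>gw_measure p) ^ j \<partial>measure_pmf p)"
proof -
  have "ennreal (exp (t * desc_sum h (Suc n) k)) = (\<Prod>i<k []. ennreal (exp (t * desc_sum h n (\<lambda>u. k (i # u)))))" for k
    by (simp add: sum_distrib_left exp_sum prod_ennreal)
  moreover have "(\<lambda>k. ennreal (exp (t * desc_sum h n k))) \<in> borel_measurable (gw_measure p)"
    by (rule measurable_compose[OF measurable_desc_sum[OF h]]) simp
  ultimately show ?thesis
    using nn_integral_branching[of "\<lambda>k. ennreal (exp (t * desc_sum h n k))" p] by (simp only:)
qed

section \<open>Upper tails for bounded offspring\<close>

locale bounded_offspring =
  fixes p :: "nat pmf" and N :: nat and m :: real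
  assumes support: "set_pmf p \<subseteq> {0..N}"
    and mean: "m = measure_pmf.expectation p real"
    and supercritical: "m > 1"
begin

lemma finite_support: "finite (set_pmf p)"
  using support by (rule finite_subset) simp

lemma integrable_offspring: "integrable (measure_pmf p) (f :: nat \<Rightarrow> real)"
  by (rule integrable_measure_pmf_finite[OF finite_support])

lemma N_pos: "N \<ge> 1"
proof (rule ccontr)
  assume "\<not> N \<ge> 1"
  then have "AE x in measure_pmf p. real x = 0" using support by (auto simp: AE_measure_pmf_iff)
  then have "m = 0" unfolding mean by (subst integral_cong_AE[of _ _ "\<lambda>_. 0"]) auto
  then show False using supercritical by simp
qed

lemma AE_offspring_le: "AE k in gw_measure p. \<forall>v. k v \<le> N"
proof -
  have "AE k in gw_measure p. k v \<le> N" for v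
  proof (rule AE_distrD[OF measurable_offspring])
    show "AE x in distr (gw_measure p) (count_space UNIV) (\<lambda>k. k v). x \<le> N"
      unfolding distr_offspring using support by (auto simp: AE_measure_pmf_iff)
  qed
  then show ?thesis by (simp add: AE_all_countable)
qed

text \<open>Bounds the quadratic error of the offspring moment generating function on
  \<open>[0, 1]\<close>: \<open>u\<^sup>2 * mgf_const\<close> dominates
  \<open>(u * j)\<^sup>2 * exp (u * j)\<close> when \<open>u \<le> 1\<close> and
  \<open>j \<le> N\<close>.\<close>

definition mgf_const :: real where "mgf_const = N\<^sup>2 * exp N"

lemma mgf_const_nonneg: "mgf_const \<ge> 0" by (simp add: mgf_const_def)

lemma offspring_mgf_le:
  assumes u: "0 \<le> u" "u \<le> 1"
  shows "(\<integral>\<^sup>+j. ennreal (exp u) ^ j \<partial>measure_pmf p) \<le> exp (m * u + mgf_const * u\<^sup>2)"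
proof -
  \<comment> \<open>The inequality \<open>exp x - 1 \<le> x * exp x\<close> is used twice, the
    second time multiplied by \<open>x\<close>.\<close>
  have taylor: "exp x \<le> 1 + x + x\<^sup>2 * exp x" if "x \<ge> 0" for x :: real
  proof -
    have "1 - x \<le> exp (- x)" using exp_ge_add_one_self[of "- x"] by simp
    then have "exp x * (1 - x) \<le> exp x * exp (- x)" by (intro mult_left_mono) auto
    then have *: "exp x - 1 \<le> x * exp x" by (simp add: exp_minus algebra_simps)
    have "x * (exp x - 1) \<le> x * (x * exp x)" using * that by (intro mult_left_mono) auto
    with * show ?thesis by (simp add: algebra_simps power2_eq_square)
  qed
  have le: "exp u ^ j \<le> 1 + u * j + mgf_const * u\<^sup>2" if "j \<in> set_pmf p" for j :: nat
  proof -
    have j: "real j \<le> N" using that support by auto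
    have "exp u ^ j = exp (u * j)" by (simp add: exp_of_nat2_mult)
    also have "\<dots> \<le> 1 + u * j + (u * j)\<^sup>2 * exp (u * j)" using u by (intro taylor) simp
    also have "(u * j)\<^sup>2 * exp (u * j) \<le> (u * N)\<^sup>2 * exp N"
    proof (intro mult_mono power_mono)
      show "exp (u * real j) \<le> exp N" using mult_mono[OF u(2) j] u by simp
    qed (use u j in \<open>auto intro: mult_left_mono\<close>)
    finally show ?thesis by (simp add: mgf_const_def power_mult_distrib mult_ac)
  qed
  have "(\<integral>\<^sup>+j. ennreal (exp u) ^ j \<partial>measure_pmf p) \<le> (\<integral>\<^sup>+j. ennreal (1 + u * j + mgf_const * u\<^sup>2) \<partial>measure_pmf p)"
    by (intro nn_integral_mono_AE) (auto simp: AE_measure_pmf_iff ennreal_power intro!: ennreal_leI le)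
  also have "\<dots> = ennreal (\<integral>j. 1 + u * j + mgf_const * u\<^sup>2 \<partial>measure_pmf p)"
    using u mgf_const_nonneg by (intro nn_integral_eq_integral integrable_offspring) auto
  also have "(\<integral>j. 1 + u * j + mgf_const * u\<^sup>2 \<partial>measure_pmf p) = 1 + m * u + mgf_const * u\<^sup>2"
    by (simp add: integrable_offspring mean)
  also have "ennreal \<dots> \<le> exp (m * u + mgf_const * u\<^sup>2)"
    using exp_ge_add_one_self[of "m * u + mgf_const * u\<^sup>2"] by (intro ennreal_leI) (simp add: add.assoc)
  finally show ?thesis .
qed

text \<open>With \<open>x\<close> the reciprocal of the exponent, one generation is the affine map
  \<open>x \<mapsto> m x + mgf_const\<close>; its fixed point \<open>- mgf_const / (m - 1)\<close> gives the shift.\<close>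

lemma generation_mgf_le:
  assumes "x \<ge> 1"
  shows "(\<integral>\<^sup>+k. exp (1 / (m ^ n * (x + mgf_const / (m - 1))) * generation_size n k) \<partial>gw_measure p) \<le> exp (1 / x)"
  using assms
proof (induction n arbitrary: x)
  case 0
  interpret prob_space "gw_measure p" by (rule prob_space_gw_measure)
  have "1 / (x + mgf_const / (m - 1)) \<le> 1 / x"
    using 0 mgf_const_nonneg supercritical by (intro divide_left_mono mult_pos_pos add_pos_nonneg) auto
  then show ?case using emeasure_space_1 by (simp add: ennreal_leI)
next
  case (Suc n)
  define y where "y = m * x + mgf_const"
  define u where "u = 1 / y"
  have y1: "y \<ge> 1"
    using mult_mono[of 1 m 1 x] Suc.prems supercritical mgf_const_nonneg by (simp add: y_def)
  then have u: "0 \<le> u" "u \<le> 1" by (auto simp: u_def)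
  \<comment> \<open>Thanks to the shift by the fixed point, \<open>Suc n\<close> generations from
    \<open>x\<close> have the same exponent as \<open>n\<close> generations from \<open>y\<close>,
    where the induction hypothesis applies.\<close>
  have eq: "m ^ Suc n * (x + mgf_const / (m - 1)) = m ^ n * (y + mgf_const / (m - 1))"
    using supercritical by (simp add: y_def field_simps)
  have x0: "x > 0" using Suc.prems by simp
  \<comment> \<open>With \<open>u = 1 / y\<close> the claim is
    \<open>x * (m * y + mgf_const) \<le> y * y\<close>; expanding one factor \<open>y\<close>
    reduces it to \<open>x * mgf_const \<le> y * mgf_const\<close>.\<close>
  have "m * u + mgf_const * u\<^sup>2 \<le> 1 / x"
  proof -
    have "x * (m * y + mgf_const) \<le> y * y"
    proof -
      have "1 * x \<le> m * x" using supercritical x0 by (intro mult_right_mono) auto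
      then have "x \<le> y" using mgf_const_nonneg by (simp add: y_def)
      then have "x * mgf_const \<le> y * mgf_const" using mgf_const_nonneg by (rule mult_right_mono)
      then show ?thesis by (simp add: y_def algebra_simps)
    qed
    moreover have "m * u + mgf_const * u\<^sup>2 = (m * y + mgf_const) / (y * y)"
      using y1 by (simp add: u_def field_simps power2_eq_square)
    moreover have "0 < y * y" using y1 by simp
    ultimately show ?thesis using x0 by (simp add: pos_divide_le_eq pos_le_divide_eq mult.commute)
  qed
  have "(\<integral>\<^sup>+k. exp (1 / (m ^ Suc n * (x + mgf_const / (m - 1))) * generation_size (Suc n) k) \<partial>gw_measure p)
     = (\<integral>\<^sup>+j. (\<integral>\<^sup>+k. exp (1 / (m ^ n * (y + mgf_const / (m - 1))) * generation_size n k) \<partial>gw_measure p) ^ j \<partial>measure_pmf p)"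
    unfolding eq by (rule nn_integral_exp_desc_sum_Suc) simp
  also have "\<dots> \<le> (\<integral>\<^sup>+j. ennreal (exp u) ^ j \<partial>measure_pmf p)"
    unfolding u_def by (intro nn_integral_mono power_mono Suc.IH y1) simp
  also have "\<dots> \<le> exp (m * u + mgf_const * u\<^sup>2)" by (rule offspring_mgf_le[OF u])
  also have "\<dots> \<le> exp (1 / x)" using \<open>m * u + mgf_const * u\<^sup>2 \<le> 1 / x\<close> by (intro ennreal_leI) simp
  finally show ?case .
qed

text \<open>The exponent of \<open>generation_mgf_le\<close> at \<open>x = 1\<close>, rescaled by
  \<open>m ^ n\<close>; the corresponding moment is at most \<open>exp 1\<close> for every
  \<open>n\<close>.\<close>

definition tail_rate :: real where "tail_rate = 1 / (1 + mgf_const / (m - 1))"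

lemma tail_rate_pos: "tail_rate > 0"
  unfolding tail_rate_def using mgf_const_nonneg supercritical by (intro divide_pos_pos add_pos_nonneg) auto

text \<open>Markov's inequality for the exponential of \<open>tail_rate / m ^ n\<close> times the
  generation size. The bound is uniform over all labels \<open>v\<close>, in the tree or not, which
  permits a union bound over a deterministic set of labels.\<close>

lemma prob_generation_size_gt_le:
  fixes a :: real
  shows "measure (gw_measure p) {k. generation_size n (\<lambda>u. k (v @ u)) > a} \<le> exp (1 - tail_rate * a / m ^ n)"
proof -
  interpret prob_space "gw_measure p" by (rule prob_space_gw_measure)
  have meas [measurable]: "generation_size n \<in> gw_measure p \<rightarrow>\<^sub>M count_space UNIV"
    by (rule measurable_desc_sum) simp
  have meas': "(\<lambda>k. ennreal (exp (tail_rate / m ^ n * generation_size n k))) \<in> borel_measurable (gw_measure p)"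
    by (rule measurable_compose[OF meas]) simp
  define g where "g k = ennreal (exp (- (tail_rate * a / m ^ n))) * ennreal (exp (tail_rate / m ^ n * generation_size n k))" for k
  have gm: "g \<in> borel_measurable (gw_measure p)"
    unfolding g_def by (rule borel_measurable_times_ennreal[OF _ meas']) simp
  have S: "{k. generation_size n k > a} \<in> sets (gw_measure p)"
    using measurable_sets[OF meas, of "{j. real j > a}"] by (simp add: vimage_def)
  have mn: "m ^ n > 0" using supercritical by simp
  have "emeasure (gw_measure p) {k. generation_size n (\<lambda>u. k (v @ u)) > a}
     = emeasure (distr (gw_measure p) (gw_measure p) (\<lambda>k u. k (v @ u))) {k. generation_size n k > a}"
    by (subst emeasure_distr[OF measurable_subtree S]) (simp add: vimage_def)
  also have "\<dots> = emeasure (gw_measure p) {k. generation_size n k > a}"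
    by (subst distr_subtree) (auto simp: inj_def)
  also have "\<dots> \<le> emeasure (gw_measure p) {k \<in> space (gw_measure p). 1 \<le> g k}"
  proof (rule emeasure_mono)
    show "{k. a < real (generation_size n k)} \<subseteq> {k \<in> space (gw_measure p). 1 \<le> g k}"
    proof
      fix k assume "k \<in> {k. a < real (generation_size n k)}"
      then have "tail_rate * a \<le> tail_rate * generation_size n k" using tail_rate_pos by simp
      then have "0 \<le> - (tail_rate * a / m ^ n) + tail_rate / m ^ n * generation_size n k"
        using mn divide_right_mono[of "tail_rate * a" "tail_rate * generation_size n k" "m ^ n"] by simp
      then have "1 \<le> exp (- (tail_rate * a / m ^ n)) * exp (tail_rate / m ^ n * generation_size n k)"
        by (simp only: exp_add[symmetric] one_le_exp_iff)
      then show "k \<in> {k \<in> space (gw_measure p). 1 \<le> g k}"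
        by (simp add: g_def ennreal_mult[symmetric])
    qed
    show "{k \<in> space (gw_measure p). 1 \<le> g k} \<in> sets (gw_measure p)"
      by (rule borel_measurable_le[OF _ gm]) simp
  qed
  also have "\<dots> \<le> (\<integral>\<^sup>+k. g k \<partial>gw_measure p)"
    using nn_integral_Markov_inequality[of g UNIV "gw_measure p" 1] gm sets.top[of "gw_measure p"]
    by simp
  also have "\<dots> = ennreal (exp (- (tail_rate * a / m ^ n))) * (\<integral>\<^sup>+k. exp (tail_rate / m ^ n * generation_size n k) \<partial>gw_measure p)"
    unfolding g_def by (rule nn_integral_cmult[OF meas'])
  also have "(\<integral>\<^sup>+k. exp (tail_rate / m ^ n * generation_size n k) \<partial>gw_measure p) \<le> exp 1"
    using generation_mgf_le[of 1 n] by (simp add: tail_rate_def mult.commute divide_simps)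
  also have "ennreal (exp (- (tail_rate * a / m ^ n))) * ennreal (exp 1) = ennreal (exp (1 - tail_rate * a / m ^ n))"
    by (simp add: ennreal_mult[symmetric] exp_add[symmetric])
  finally show ?thesis by (simp add: emeasure_eq_measure mult_left_mono)
qed




lemma sets_generation_size_gt:
  "{k. generation_size n (\<lambda>u. k (v @ u)) > (a::real)} \<in> sets (gw_measure p)"
proof -
  have "(\<lambda>k. generation_size n (\<lambda>u. k (v @ u))) \<in> gw_measure p \<rightarrow>\<^sub>M count_space UNIV"
    by (rule measurable_compose[OF measurable_subtree measurable_desc_sum]) simp
  from measurable_sets[OF this, of "{j. real j > a}"] show ?thesis by (simp add: vimage_def)
qed

lemma powr_ge_linear: "real n * (\<delta> * ln m) \<le> m powr (\<delta> * n)"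
proof -
  have "m powr (\<delta> * n) = exp (\<delta> * n * ln m)" using supercritical by (simp add: powr_def)
  moreover have "real n * (\<delta> * ln m) = \<delta> * n * ln m" by simp
  ultimately show ?thesis using exp_ge_add_one_self[of "\<delta> * n * ln m"] by linarith
qed

lemma card_short_labels_le: "card {v. set v \<subseteq> {..<N} \<and> length v \<le> l} \<le> (N + 1) ^ l"
proof -
  have "(\<Sum>i\<le>l. N ^ i) \<le> (N + 1) ^ l"
  proof (induction l)
    case (Suc l)
    have "N * N ^ l \<le> N * (N + 1) ^ l" by (intro mult_le_mono2 power_mono) auto
    from add_mono[OF Suc this] show ?case by simp
  qed simp
  then show ?thesis by (simp add: card_lists_length_le)
qed

lemma AE_generation_size_bound:
  assumes eps: "0 < \<epsilon>" "\<epsilon> < \<epsilon>'" and A: "A > 0"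
  shows "AE k in gw_measure p. \<exists>C>0. \<forall>n v. real (length v) \<le> A * m powr (\<epsilon> * n) \<and> set v \<subseteq> {..<N}
     \<longrightarrow> generation_size n (\<lambda>u. k (v @ u)) \<le> C * m powr ((1 + \<epsilon>') * n)"
proof -
  interpret prob_space "gw_measure p" by (rule prob_space_gw_measure)
  define x where "x n = m powr (\<epsilon> * real n)" for n
  define V where "V n = {v. set v \<subseteq> {..<N} \<and> length v \<le> nat \<lfloor>A * x n\<rfloor>}" for n
  define big where "big n v = {k. generation_size n (\<lambda>u. k (v @ u)) > m powr ((1 + \<epsilon>') * n)}" for n v
  define bad where "bad n = (\<Union>v\<in>V n. big n v)" for n
  have finV: "finite (V n)" for n
    unfolding V_def by (rule finite_lists_length_le) simp
  have big_sets: "big n v \<in> sets (gw_measure p)" for n v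
    unfolding big_def by (rule sets_generation_size_gt)
  have bad_sets: "bad n \<in> sets (gw_measure p)" for n
    unfolding bad_def by (intro sets.finite_UN finV big_sets)
  define l where "l = ln (real N + 1)"
  have l0: "l \<ge> 0" by (simp add: l_def)
  have prob_bad: "prob (bad n) \<le> exp (l * A * x n + 1 - tail_rate * m powr (\<epsilon>' * n))" for n
  proof -
    have "prob (bad n) \<le> (\<Sum>v\<in>V n. prob (big n v))"
      unfolding bad_def by (rule finite_measure_subadditive_finite) (use finV big_sets in auto)
    also have "\<dots> \<le> (\<Sum>v\<in>V n. exp (1 - tail_rate * m powr (\<epsilon>' * n)))"
    proof (rule sum_mono)
      fix v assume "v \<in> V n"
      have "m powr ((1 + \<epsilon>') * n) / m ^ n = m powr (\<epsilon>' * n)"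
        using supercritical by (simp add: powr_realpow[symmetric] powr_diff[symmetric] algebra_simps)
      then show "prob (big n v) \<le> exp (1 - tail_rate * m powr (\<epsilon>' * n))"
        using prob_generation_size_gt_le[where n = n and v = v and a = "m powr ((1 + \<epsilon>') * n)"]
        by (simp add: big_def times_divide_eq_right[symmetric] del: times_divide_eq_right)
    qed
    also have "\<dots> = card (V n) * exp (1 - tail_rate * m powr (\<epsilon>' * n))" by simp
    also have "\<dots> \<le> exp (l * A * x n) * exp (1 - tail_rate * m powr (\<epsilon>' * n))"
    proof (rule mult_right_mono)
      have "real (card (V n)) \<le> real ((N + 1) ^ nat \<lfloor>A * x n\<rfloor>)"
        unfolding V_def of_nat_le_iff by (rule card_short_labels_le)
      also have "\<dots> = exp (l * nat \<lfloor>A * x n\<rfloor>)"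
        by (simp add: l_def exp_of_nat2_mult add.commute)
      also have "\<dots> \<le> exp (l * (A * x n))"
        using A l0 by (auto simp: x_def intro!: mult_left_mono)
      finally show "real (card (V n)) \<le> exp (l * A * x n)" by (simp add: mult_ac)
    qed simp
    also have "\<dots> = exp (l * A * x n + 1 - tail_rate * m powr (\<epsilon>' * n))"
      by (simp add: exp_add[symmetric])
    finally show ?thesis .
  qed
  have lnm: "ln m > 0" using supercritical by simp
  \<comment> \<open>From here on \<open>tail_rate * m powr ((\<epsilon>' - \<epsilon>) * n)\<close>
    exceeds \<open>l * A + 1\<close>: the part \<open>l * A\<close> pays for the number of labels,
    and the extra \<open>1\<close> leaves \<open>- x n\<close> in the exponent for
    summability.\<close>
  define n\<^sub>0 where "n\<^sub>0 = nat \<lceil>(l * A + 1) / (tail_rate * ((\<epsilon>' - \<epsilon>) * ln m))\<rceil>"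
  have prob_bad': "norm (prob (bad n)) \<le> exp 1 * exp (- (\<epsilon> * ln m)) ^ n" if "n \<ge> n\<^sub>0" for n
  proof -
    have d: "tail_rate * ((\<epsilon>' - \<epsilon>) * ln m) > 0" using tail_rate_pos eps lnm by simp
    have "(l * A + 1) / (tail_rate * ((\<epsilon>' - \<epsilon>) * ln m)) \<le> n" using that by (simp add: n\<^sub>0_def nat_le_iff ceiling_le_iff)
    then have "l * A + 1 \<le> tail_rate * (n * ((\<epsilon>' - \<epsilon>) * ln m))"
      using d by (simp add: pos_divide_le_eq mult_ac)
    also have "\<dots> \<le> tail_rate * m powr ((\<epsilon>' - \<epsilon>) * n)"
      using powr_ge_linear tail_rate_pos by (intro mult_left_mono) auto
    finally have "(l * A + 1) * x n \<le> tail_rate * m powr ((\<epsilon>' - \<epsilon>) * n) * x n"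
      by (rule mult_right_mono) (simp add: x_def)
    also have "\<dots> = tail_rate * m powr (\<epsilon>' * n)"
      by (simp add: x_def powr_add[symmetric] algebra_simps)
    finally have "l * A * x n + 1 - tail_rate * m powr (\<epsilon>' * n) \<le> 1 - x n" by (simp add: algebra_simps)
    also have "\<dots> \<le> 1 - real n * (\<epsilon> * ln m)" using powr_ge_linear[of n \<epsilon>] by (simp add: x_def)
    finally have "exp (l * A * x n + 1 - tail_rate * m powr (\<epsilon>' * n)) \<le> exp (1 - real n * (\<epsilon> * ln m))" by simp
    also have "\<dots> = exp 1 * exp (- (\<epsilon> * ln m)) ^ n"
      by (simp add: exp_of_nat_mult[symmetric] exp_add[symmetric])
    finally show ?thesis using prob_bad[of n] by (simp add: measure_nonneg)
  qed
  have "summable (\<lambda>n. exp 1 * exp (- (\<epsilon> * ln m)) ^ n)"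
    using eps lnm by (intro summable_mult summable_geometric) simp
  then have "summable (\<lambda>n. prob (bad n))"
    by (rule summable_comparison_test'[of _ n\<^sub>0]) (rule prob_bad')
  then have "AE k in gw_measure p. eventually (\<lambda>n. k \<in> space (gw_measure p) - bad n) sequentially"
    by (intro borel_cantelli_AE1 bad_sets) (auto simp: emeasure_eq_measure)
  then show ?thesis using AE_offspring_le
  proof eventually_elim
    case (elim k)
    then obtain n\<^sub>1 where n1: "\<And>n. n \<ge> n\<^sub>1 \<Longrightarrow> k \<notin> bad n" by (auto simp: eventually_sequentially)
    show ?case
    \<comment> \<open>The constant absorbs the finitely many \<open>n < n\<^sub>1\<close>, where the
      deterministic bound \<open>N ^ n\<close> holds.\<close>
    proof (intro exI[of _ "real (N ^ n\<^sub>1)"] conjI allI impI)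
      show "real (N ^ n\<^sub>1) > 0" using N_pos by simp
      fix n :: nat and v assume v: "real (length v) \<le> A * m powr (\<epsilon> * n) \<and> set v \<subseteq> {..<N}"
      have C1: "real (N ^ n\<^sub>1) \<ge> 1" using N_pos by simp
      have P1: "m powr ((1 + \<epsilon>') * n) \<ge> 1" using supercritical eps by (intro ge_one_powr_ge_zero) auto
      show "generation_size n (\<lambda>u. k (v @ u)) \<le> real (N ^ n\<^sub>1) * m powr ((1 + \<epsilon>') * n)"
      proof (cases "n \<ge> n\<^sub>1")
        case True
        have "v \<in> V n" using v A unfolding V_def x_def by (auto simp: le_nat_floor)
        then have "generation_size n (\<lambda>u. k (v @ u)) \<le> m powr ((1 + \<epsilon>') * n)"
          using n1[OF True] unfolding bad_def big_def by auto
        also have "\<dots> \<le> real (N ^ n\<^sub>1) * m powr ((1 + \<epsilon>') * n)"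
          using mult_right_mono[OF C1, of "m powr ((1 + \<epsilon>') * n)"] by simp
        finally show ?thesis .
      next
        case False
        have "generation_size n (\<lambda>u. k (v @ u)) \<le> N ^ n"
          using elim(2) by (intro generation_size_le) auto
        also have "\<dots> \<le> N ^ n\<^sub>1" using False N_pos by (intro power_increasing) auto
        finally have "real (generation_size n (\<lambda>u. k (v @ u))) \<le> real (N ^ n\<^sub>1)" by (rule of_nat_mono)
        also have "\<dots> \<le> real (N ^ n\<^sub>1) * m powr ((1 + \<epsilon>') * n)"
          using mult_left_mono[OF P1, of "real (N ^ n\<^sub>1)"] by simp
        finally show ?thesis .
      qed
    qed
  qed
qed

end

subsection \<open>Growth of the surviving generations\<close>

text \<open>Bernoulli's inequality for real exponents, as the weighted arithmetic-geometric mean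
  inequality of \<open>z powr M\<close> and \<open>1\<close> with weights \<open>1 / M\<close> and
  \<open>1 - 1 / M\<close>.\<close>

lemma Bernoulli_powr:
  fixes M z :: real
  assumes "M > 1" "z > 0"
  shows "1 + M * (z - 1) \<le> z powr M"
proof -
  have "(z powr M) powr (1 / M) * 1 powr (1 - 1 / M) \<le> (1 / M) * z powr M + (1 - 1 / M) * 1"
    using assms by (intro Youngs_inequality_0) auto
  then have "z \<le> (1 / M) * z powr M + (1 - 1 / M)"
    using assms by (simp add: powr_powr)
  then have "M * z \<le> M * ((1 / M) * z powr M + (1 - 1 / M))"
    using assms by (intro mult_left_mono) auto
  then show ?thesis using assms by (simp add: algebra_simps)
qed

text \<open>Iterating \<open>contraction a M\<close> is explicit: it is multiplication by \<open>M\<close> in the coordinate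
  \<open>s powr (- a) - 1\<close>.\<close>

definition contraction :: "real \<Rightarrow> real \<Rightarrow> real \<Rightarrow> real" where
  "contraction a M s = (1 + M * (s powr (- a) - 1)) powr (- 1 / a)"

lemma contraction_base_ge_1:
  fixes a M s :: real
  assumes "a > 0" "M > 0" "0 < s" "s \<le> 1"
  shows "1 + M * (s powr (- a) - 1) \<ge> 1"
proof -
  have "s powr (- a) \<ge> 1"
    using assms powr_mono2'[of "- a" s 1] by simp
  then show ?thesis using assms by simp
qed

lemma contraction_bounds:
  assumes "a > 0" "M > 0" "0 < s" "s \<le> 1"
  shows "0 < contraction a M s" "contraction a M s \<le> 1"
proof -
  note * = contraction_base_ge_1[OF assms]
  show "0 < contraction a M s" using * by (simp add: contraction_def)
  have "contraction a M s \<le> 1 powr (- 1 / a)"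
    unfolding contraction_def using * assms by (intro powr_mono2') auto
  then show "contraction a M s \<le> 1" by simp
qed

lemma contraction_compose:
  assumes "a > 0" "M > 0" "0 < s" "s \<le> 1"
  shows "contraction a K (contraction a M s) = contraction a (K * M) s"
proof -
  have "contraction a M s powr (- a) = 1 + M * (s powr (- a) - 1)"
    unfolding contraction_def using contraction_base_ge_1[OF assms] assms by (simp add: powr_powr)
  then show ?thesis by (simp add: contraction_def[of a K] contraction_def[of a "K * M"] mult.assoc)
qed

text \<open>Bernoulli at \<open>z = s powr (- a)\<close>; the negative outer exponent reverses the
  inequality. This comparison serves \<open>s\<close> near \<open>1\<close>.\<close>

lemma powr_le_contraction:
  assumes "a > 0" "M > 1" "0 < s" "s \<le> 1"
  shows "s powr M \<le> contraction a M s"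
proof -
  have "s powr M = ((s powr (- a)) powr M) powr (- 1 / a)"
    using assms by (simp add: powr_powr)
  also have "\<dots> \<le> contraction a M s"
    unfolding contraction_def using assms contraction_base_ge_1[of a M s]
    by (intro powr_mono2' Bernoulli_powr) auto
  finally show ?thesis .
qed

text \<open>Dropping the negative term \<open>1 - M\<close> from the base gives a linear lower
  bound, which serves \<open>s\<close> away from \<open>1\<close>.\<close>

lemma mult_le_contraction:
  assumes "a > 0" "M > 1" "0 < s" "s \<le> 1"
  shows "M powr (- 1 / a) * s \<le> contraction a M s"
proof -
  have "M powr (- 1 / a) * s = (M * s powr (- a)) powr (- 1 / a)"
    using assms by (simp add: powr_mult powr_powr)
  also have "\<dots> \<le> contraction a M s"
  proof -
    have "1 + M * (s powr (- a) - 1) \<le> M * s powr (- a)" using assms by (simp add: algebra_simps)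
    then show ?thesis
      unfolding contraction_def using assms contraction_base_ge_1[of a M s]
      by (intro powr_mono2') auto
  qed
  finally show ?thesis .
qed

section \<open>The generating function and its iterates\<close>

context bounded_offspring
begin

definition gf :: "real \<Rightarrow> real" where
  "gf x = (\<Sum>j\<le>N. pmf p j * x ^ j)"

lemma nn_integral_power_eq_gf:
  assumes "x \<ge> 0"
  shows "(\<integral>\<^sup>+j. ennreal x ^ j \<partial>measure_pmf p) = gf x"
proof -
  have "(\<integral>\<^sup>+j. ennreal x ^ j \<partial>measure_pmf p) = (\<Sum>j\<le>N. ennreal x ^ j * pmf p j)"
    using support by (intro nn_integral_measure_pmf_support) auto
  also have "\<dots> = (\<Sum>j\<le>N. ennreal (pmf p j * x ^ j))"
    using assms by (intro sum.cong) (auto simp: ennreal_power ennreal_mult mult.commute)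
  finally show ?thesis using assms by (simp add: gf_def)
qed

lemma gf_1: "gf 1 = 1"
  unfolding gf_def using support by (simp add: sum_pmf_eq_1 subset_eq)

lemma gf_nonneg: "x \<ge> 0 \<Longrightarrow> gf x \<ge> 0"
  by (simp add: gf_def sum_nonneg)

lemma gf_mono: "0 \<le> x \<Longrightarrow> x \<le> y \<Longrightarrow> gf x \<le> gf y"
  unfolding gf_def by (intro sum_mono mult_left_mono power_mono) auto

lemma gf_deriv_1: "(gf has_real_derivative m) (at 1)"
proof -
  have "(gf has_real_derivative (\<Sum>j\<le>N. pmf p j * j)) (at 1)"
    unfolding gf_def[abs_def] by (auto intro!: derivative_eq_intros simp: mult.commute)
  also have "(\<Sum>j\<le>N. pmf p j * j) = m"
    unfolding mean using support by (subst integral_measure_pmf_real[of "{..N}"]) (auto simp: mult.commute)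
  finally show ?thesis .
qed

lemma gf_convex: "convex_on {0..} gf"
proof -
  have power: "convex_on {0..} (\<lambda>x::real. x ^ j)" for j
    by (cases "even j") (auto intro: convex_power_odd convex_on_subset[OF convex_power_even])
  have "convex_on {0..} (\<lambda>x. \<Sum>j\<in>S. pmf p j * x ^ j)" if "finite S" for S
    using that
  proof (induction S rule: finite_induct)
    case empty
    then show ?case by (simp add: convex_on_const)
  next
    case (insert j S)
    then show ?case by (simp add: convex_on_add convex_on_cmul power)
  qed
  then show ?thesis unfolding gf_def[abs_def] by simp
qed

text \<open>One step is compared in two regimes. Near \<open>s = 1\<close> the slope
  \<open>m > M\<close> puts \<open>gf\<close> below \<open>s powr M\<close>, up to the affine change
  of variable; below a threshold \<open>s\<^sub>0\<close>, convexity puts it under the chord from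
  the fixed point \<open>q\<close>. A suitable \<open>a\<close> makes one contraction dominate
  both.\<close>

lemma gf_iterates_le:
  assumes M: "1 < M" "M < m" and q: "0 \<le> q" "q < 1" "gf q = q"
  shows "\<exists>a>0. \<forall>n s. 0 < s \<and> s \<le> 1 \<longrightarrow> (gf ^^ n) (q + (1 - q) * s) \<le> q + (1 - q) * contraction a (M ^ n) s"
proof -
  \<comment> \<open>The gap between the two sides in the coordinate \<open>s = exp (- y)\<close>; it
    vanishes at \<open>0\<close> with slope \<open>(1 - q) * (m - M) > 0\<close>.\<close>
  define D where "D y = q + (1 - q) * exp (- M * y) - gf (q + (1 - q) * exp (- y))" for y
  have inner: "((\<lambda>y. q + (1 - q) * exp (- y)) has_real_derivative - (1 - q)) (at 0)"
    by (auto intro!: derivative_eq_intros)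
  have "(gf has_real_derivative m) (at (q + (1 - q) * exp (- 0)))" using gf_deriv_1 by simp
  from DERIV_chain2[OF this inner]
  have "((\<lambda>y. gf (q + (1 - q) * exp (- y))) has_real_derivative m * - (1 - q)) (at 0)" .
  then have "(D has_real_derivative (1 - q) * (m - M)) (at 0)"
    unfolding D_def[abs_def] by (auto intro!: derivative_eq_intros simp: algebra_simps)
  moreover have "(1 - q) * (m - M) > 0" using M q by simp
  ultimately obtain d where d: "d > 0" "\<And>h. 0 < h \<Longrightarrow> h < d \<Longrightarrow> D 0 < D (0 + h)"
    using DERIV_pos_inc_right by blast
  \<comment> \<open>Halving \<open>d\<close> keeps the endpoint \<open>s = s\<^sub>0\<close> inside
    the open range where \<open>D\<close> is positive.\<close>
  define y\<^sub>0 where "y\<^sub>0 = d / 2"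
  define s\<^sub>0 where "s\<^sub>0 = exp (- y\<^sub>0)"
  have y0: "y\<^sub>0 > 0" "y\<^sub>0 < d" using d by (auto simp: y\<^sub>0_def)
  have s0: "0 < s\<^sub>0" "s\<^sub>0 < 1" using y0 by (auto simp: s\<^sub>0_def)
  \<comment> \<open>Chosen so that \<open>M powr (- 1 / a) = s\<^sub>0 powr (M - 1)\<close>: the
    linear bound of \<open>mult_le_contraction\<close> is then exactly the chord reaching height
    \<open>s\<^sub>0 powr M\<close> at \<open>s\<^sub>0\<close>.\<close>
  define a where "a = ln M / (y\<^sub>0 * (M - 1))"
  have a: "a > 0" using M y0 by (simp add: a_def)
  have near: "gf (q + (1 - q) * s) \<le> q + (1 - q) * s powr M" if s: "s\<^sub>0 \<le> s" "s \<le> 1" for s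
  proof (cases "s = 1")
    case True
    then show ?thesis by (simp add: gf_1)
  next
    case False
    have sp: "0 < s" using s s0 by simp
    have "- ln s > 0" using False s sp by simp
    moreover have "- ln s < d"
      using s s0 y0 ln_mono[OF s(1) s0(1)] by (simp add: s\<^sub>0_def)
    ultimately have "D 0 < D (- ln s)" using d(2)[of "- ln s"] by simp
    moreover have "D 0 = 0" by (simp add: D_def gf_1)
    ultimately show ?thesis using sp by (simp add: D_def powr_def mult.commute)
  qed
  have step: "gf (q + (1 - q) * s) \<le> q + (1 - q) * contraction a M s" if s: "0 < s" "s \<le> 1" for s
  proof (cases "s\<^sub>0 \<le> s")
    case True
    have "(1 - q) * s powr M \<le> (1 - q) * contraction a M s"
      using q M a s by (intro mult_left_mono powr_le_contraction) auto
    then show ?thesis using near[OF True s(2)] by simp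
  next
    case False
    define t where "t = s / s\<^sub>0"
    have t: "0 \<le> t" "t \<le> 1" using False s s0 by (auto simp: t_def)
    have "gf ((1 - t) *\<^sub>R q + t *\<^sub>R (q + (1 - q) * s\<^sub>0)) \<le> (1 - t) * gf q + t * gf (q + (1 - q) * s\<^sub>0)"
      using t q s0 by (intro convex_onD[OF gf_convex]) auto
    also have "(1 - t) *\<^sub>R q + t *\<^sub>R (q + (1 - q) * s\<^sub>0) = q + (1 - q) * s"
      using s0 by (simp add: t_def field_simps)
    also have "(1 - t) * gf q + t * gf (q + (1 - q) * s\<^sub>0) \<le> (1 - t) * q + t * (q + (1 - q) * s\<^sub>0 powr M)"
      using near[of s\<^sub>0] t s0 q by (intro add_mono mult_left_mono) auto
    also have "\<dots> = q + (1 - q) * (t * s\<^sub>0 powr M)" by (simp add: algebra_simps)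
    also have "t * s\<^sub>0 powr M = M powr (- 1 / a) * s"
    proof -
      have "M powr (- 1 / a) = exp (- y\<^sub>0 * (M - 1))"
        using M y0 by (simp add: powr_def a_def)
      also have "\<dots> = s\<^sub>0 powr M / s\<^sub>0"
        by (simp add: s\<^sub>0_def powr_def exp_diff[symmetric] algebra_simps)
      finally show ?thesis by (simp add: t_def)
    qed
    also have "q + (1 - q) * (M powr (- 1 / a) * s) \<le> q + (1 - q) * contraction a M s"
      using q M a s by (intro add_left_mono mult_left_mono mult_le_contraction) auto
    finally show ?thesis .
  qed
  \<comment> \<open>Nonnegativity is carried along because \<open>gf\<close> is monotone only on
    nonnegative arguments.\<close>
  have "0 \<le> (gf ^^ n) (q + (1 - q) * s) \<and> (gf ^^ n) (q + (1 - q) * s) \<le> q + (1 - q) * contraction a (M ^ n) s"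
    if s: "0 < s" "s \<le> 1" for n s
  proof (induction n)
    case 0
    have "contraction a 1 s = s" using s a by (simp add: contraction_def powr_powr)
    then show ?case using q s by simp
  next
    case (Suc n)
    have Mn: "M ^ n > 0" using M by simp
    note b = contraction_bounds[OF a Mn s]
    have "gf ((gf ^^ n) (q + (1 - q) * s)) \<le> gf (q + (1 - q) * contraction a (M ^ n) s)"
      using Suc by (intro gf_mono) auto
    also have "\<dots> \<le> q + (1 - q) * contraction a M (contraction a (M ^ n) s)"
      by (rule step[OF b])
    also have "contraction a M (contraction a (M ^ n) s) = contraction a (M ^ Suc n) s"
      using contraction_compose[OF a Mn s] by simp
    finally show ?case using Suc by (simp add: gf_nonneg)
  qed
  with a show ?thesis by blast
qed

end

section \<open>Extinction and the growth of surviving generations\<close>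

context bounded_offspring
begin

definition extinction_prob :: real where
  "extinction_prob = measure (gw_measure p) {k. finite (tree_of k)}"

lemma sets_finite_tree: "{k. finite (tree_of k)} \<in> sets (gw_measure p)"
  using measurable_finite_tree[of p] by (simp add: pred_def)

lemma sets_infinite_tree: "{k. infinite (tree_of k)} \<in> sets (gw_measure p)"
  using sets.compl_sets[OF sets_finite_tree] by (simp add: Compl_eq_Diff_UNIV[symmetric] Collect_neg_eq)

lemma extinction_prob_bounds: "0 \<le> extinction_prob" "extinction_prob \<le> 1"
proof -
  interpret prob_space "gw_measure p" by (rule prob_space_gw_measure)
  show "0 \<le> extinction_prob" "extinction_prob \<le> 1" by (auto simp: extinction_prob_def)
qed

lemma emeasure_finite_tree: "emeasure (gw_measure p) {k. finite (tree_of k)} = extinction_prob"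
proof -
  interpret prob_space "gw_measure p" by (rule prob_space_gw_measure)
  show ?thesis by (simp add: emeasure_eq_measure extinction_prob_def)
qed

lemma emeasure_infinite_tree: "emeasure (gw_measure p) {k. infinite (tree_of k)} = 1 - extinction_prob"
proof -
  interpret prob_space "gw_measure p" by (rule prob_space_gw_measure)
  show ?thesis
    using prob_compl[OF sets_finite_tree]
    by (simp add: emeasure_eq_measure extinction_prob_def Compl_eq_Diff_UNIV[symmetric] Collect_neg_eq)
qed

text \<open>The extinction indicator is the product of the extinction indicators of the subtrees of
  the root, so the branching property yields the fixed point equation.\<close>

lemma gf_extinction_prob: "gf extinction_prob = extinction_prob"
proof -
  let ?H = "indicator {k. finite (tree_of k)} :: _ \<Rightarrow> ennreal"
  have prod_ind: "(\<Prod>i<n. ?H (g i)) = (if \<forall>i<n. finite (tree_of (g i)) then 1 else 0)"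
    for n and g :: "nat \<Rightarrow> nat list \<Rightarrow> nat"
    by (induction n) (auto simp: indicator_def less_Suc_eq)
  have "?H k = (\<Prod>i<k []. ?H (\<lambda>u. k (i # u)))" for k
    unfolding prod_ind by (simp add: indicator_def finite_tree_of_iff[of k])
  then have "ennreal extinction_prob = (\<integral>\<^sup>+k. (\<Prod>i<k []. ?H (\<lambda>u. k (i # u))) \<partial>gw_measure p)"
    unfolding emeasure_finite_tree[symmetric] nn_integral_indicator[OF sets_finite_tree, symmetric]
    by (intro nn_integral_cong)
  also have "\<dots> = (\<integral>\<^sup>+j. ennreal extinction_prob ^ j \<partial>measure_pmf p)"
    by (subst nn_integral_branching)
      (simp_all add: sets_finite_tree emeasure_finite_tree)
  also have "\<dots> = gf extinction_prob" by (rule nn_integral_power_eq_gf[OF extinction_prob_bounds(1)])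
  finally show ?thesis using extinction_prob_bounds gf_nonneg by simp
qed

lemma measurable_survival_indicator:
  "(\<lambda>k. if infinite (tree_of k) then 1 else 0 :: nat) \<in> gw_measure p \<rightarrow>\<^sub>M count_space UNIV"
  by (rule measurable_If) (simp_all add: sets_infinite_tree)

text \<open>At level \<open>0\<close> the size is the survival indicator, which gives the starting
  point; each further generation applies \<open>gf\<close> once.\<close>

lemma nn_integral_exp_surviving_size:
  fixes y :: real
  shows "(\<integral>\<^sup>+k. exp (- y * surviving_size n k) \<partial>gw_measure p) = (gf ^^ n) (extinction_prob + (1 - extinction_prob) * exp (- y))"
proof (induction n)
  case 0
  have "(\<integral>\<^sup>+k. exp (- y * surviving_size 0 k) \<partial>gw_measure p)
     = (\<integral>\<^sup>+k. indicator {k. finite (tree_of k)} k + ennreal (exp (- y)) * indicator {k. infinite (tree_of k)} k \<partial>gw_measure p)"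
    by (intro nn_integral_cong) (simp add: indicator_def)
  also have "\<dots> = ennreal extinction_prob + exp (- y) * ennreal (1 - extinction_prob)"
    using sets_finite_tree sets_infinite_tree
    by (simp add: nn_integral_add nn_integral_cmult_indicator emeasure_finite_tree emeasure_infinite_tree)
  also have "\<dots> = extinction_prob + (1 - extinction_prob) * exp (- y)"
    using extinction_prob_bounds by (simp add: ennreal_mult[symmetric] ennreal_plus[symmetric] mult.commute del: ennreal_plus)
  finally show ?case by simp
next
  case (Suc n)
  have nonneg: "(gf ^^ n) (extinction_prob + (1 - extinction_prob) * exp (- y)) \<ge> 0"
    using extinction_prob_bounds by (induction n) (auto simp: gf_nonneg)
  have "(\<integral>\<^sup>+k. exp (- y * surviving_size (Suc n) k) \<partial>gw_measure p)
     = (\<integral>\<^sup>+j. (\<integral>\<^sup>+k. exp (- y * surviving_size n k) \<partial>gw_measure p) ^ j \<partial>measure_pmf p)"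
    by (rule nn_integral_exp_desc_sum_Suc[OF measurable_survival_indicator])
  also have "\<dots> = (gf ^^ Suc n) (extinction_prob + (1 - extinction_prob) * exp (- y))"
    unfolding Suc.IH by (simp add: nn_integral_power_eq_gf[OF nonneg])
  finally show ?case .
qed

text \<open>On extinction the surviving size is \<open>0\<close> and the integrand is
  \<open>1\<close>, so that event contributes exactly \<open>extinction_prob\<close>.\<close>

lemma nn_integral_exp_surviving_size_survival:
  fixes y :: real
  shows "(\<integral>\<^sup>+k. ennreal (exp (- y * surviving_size n k)) * indicator {k. infinite (tree_of k)} k \<partial>gw_measure p)
     = (gf ^^ n) (extinction_prob + (1 - extinction_prob) * exp (- y)) - extinction_prob"
proof -
  let ?E = "\<lambda>k. ennreal (exp (- y * surviving_size n k))"
  let ?I = "\<integral>\<^sup>+k. ?E k * indicator {k. infinite (tree_of k)} k \<partial>gw_measure p"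
  have Em: "?E \<in> borel_measurable (gw_measure p)"
    by (rule measurable_compose[OF measurable_desc_sum[OF measurable_survival_indicator]]) simp
  have "?E k = ?E k * indicator {k. infinite (tree_of k)} k + indicator {k. finite (tree_of k)} k" for k
    using surviving_size_eq_0_iff[of n k] by (auto simp: indicator_def)
  then have "(\<integral>\<^sup>+k. ?E k \<partial>gw_measure p)
     = (\<integral>\<^sup>+k. ?E k * indicator {k. infinite (tree_of k)} k + indicator {k. finite (tree_of k)} k \<partial>gw_measure p)"
    by (intro nn_integral_cong)
  also have "\<dots> = ?I + ennreal extinction_prob"
  proof -
    have "(\<lambda>k. ?E k * indicator {k. infinite (tree_of k)} k) \<in> borel_measurable (gw_measure p)"
      by (intro borel_measurable_times_ennreal Em borel_measurable_indicator sets_infinite_tree)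
    from nn_integral_add[OF this borel_measurable_indicator[OF sets_finite_tree]]
    show ?thesis
      unfolding nn_integral_indicator[OF sets_finite_tree] emeasure_finite_tree .
  qed
  finally have eq: "ennreal ((gf ^^ n) (extinction_prob + (1 - extinction_prob) * exp (- y))) = ?I + ennreal extinction_prob"
    unfolding nn_integral_exp_surviving_size .
  show ?thesis
    unfolding ennreal_minus[OF extinction_prob_bounds(1), symmetric] eq by simp
qed

text \<open>Markov's inequality for the Laplace transform restricted to survival, with
  \<open>gf_iterates_le\<close>, bounds the bad events by a geometric series.\<close>

lemma AE_surviving_size_ge:
  fixes M' :: real
  assumes M': "1 < M'" "M' < m"
  shows "AE k in gw_measure p. infinite (tree_of k) \<longrightarrow> (\<forall>\<^sub>F n in sequentially. surviving_size n k \<ge> M' ^ n)"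
proof (cases "extinction_prob = 1")
  \<comment> \<open>Here survival has probability zero; \<open>gf_iterates_le\<close> is applied
    only when \<open>extinction_prob < 1\<close>.\<close>
  case True
  interpret prob_space "gw_measure p" by (rule prob_space_gw_measure)
  have "AE k in gw_measure p. k \<in> {k. finite (tree_of k)}"
    by (rule AE_prob_1) (use True in \<open>simp add: extinction_prob_def\<close>)
  then show ?thesis by eventually_elim simp
next
  case False
  interpret prob_space "gw_measure p" by (rule prob_space_gw_measure)
  \<comment> \<open>A growth rate strictly between \<open>M'\<close> and \<open>m\<close>; the ratio
    \<open>M / M' > 1\<close> produces the geometric decay.\<close>
  define M where "M = (M' + m) / 2"
  have M: "1 < M" "M < m" "M' < M" using M' by (auto simp: M_def)
  have q: "0 \<le> extinction_prob" "extinction_prob < 1" using extinction_prob_bounds False by auto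
  obtain a where a: "a > 0" and bound: "\<And>n s. 0 < s \<Longrightarrow> s \<le> 1 \<Longrightarrow>
      (gf ^^ n) (extinction_prob + (1 - extinction_prob) * s) \<le> extinction_prob + (1 - extinction_prob) * contraction a (M ^ n) s"
    using gf_iterates_le[OF M(1,2) q gf_extinction_prob] by blast
  define bad where "bad n = {k. infinite (tree_of k) \<and> surviving_size n k < M' ^ n}" for n
  have bad_sets: "bad n \<in> sets (gw_measure p)" for n
  proof -
    have "{k. real (surviving_size n k) < M' ^ n} \<in> sets (gw_measure p)"
      using measurable_sets[OF measurable_desc_sum[OF measurable_survival_indicator], of "{j. real j < M' ^ n}" n]
      by (simp add: vimage_def)
    from sets.Int[OF sets_infinite_tree this] show ?thesis
      by (simp only: bad_def Collect_conj_eq)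
  qed
  have prob_bad: "norm (prob (bad n)) \<le> exp 1 * (a powr (- 1 / a) * ((M / M') powr (- 1 / a)) ^ n)" for n
  proof -
    \<comment> \<open>At this scale the exponential is at least \<open>exp (- 1)\<close> on
      \<open>bad n\<close>, so Markov's inequality costs only a factor \<open>exp 1\<close>.\<close>
    define y where "y = 1 / M' ^ n"
    have y: "y > 0" using M' by (simp add: y_def)
    have "emeasure (gw_measure p) (bad n) = (\<integral>\<^sup>+k. indicator (bad n) k \<partial>gw_measure p)"
      by (rule nn_integral_indicator[OF bad_sets, symmetric])
    also have "\<dots> \<le> (\<integral>\<^sup>+k. ennreal (exp 1) * (ennreal (exp (- y * surviving_size n k)) * indicator {k. infinite (tree_of k)} k) \<partial>gw_measure p)"
    proof (rule nn_integral_mono)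
      fix k
      show "indicator (bad n) k \<le> ennreal (exp 1) * (ennreal (exp (- y * surviving_size n k)) * indicator {k. infinite (tree_of k)} k)"
      proof (cases "k \<in> bad n")
        case True
        then have "y * surviving_size n k \<le> 1" using M' by (simp add: bad_def y_def divide_le_eq)
        then have "1 \<le> exp 1 * exp (- y * surviving_size n k)" by (simp add: exp_add[symmetric])
        then show ?thesis using True by (simp add: bad_def ennreal_mult[symmetric])
      qed simp
    qed
    also have "\<dots> = exp 1 * ennreal ((gf ^^ n) (extinction_prob + (1 - extinction_prob) * exp (- y)) - extinction_prob)"
      unfolding nn_integral_exp_surviving_size_survival[symmetric]
      by (rule nn_integral_cmult)
        (intro borel_measurable_times_ennreal measurable_compose[OF measurable_desc_sum[OF measurable_survival_indicator]]
          borel_measurable_indicator sets_infinite_tree, simp)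
    also have "\<dots> \<le> exp 1 * ennreal (a powr (- 1 / a) * ((M / M') powr (- 1 / a)) ^ n)"
    proof (intro mult_left_mono ennreal_leI)
      have "(gf ^^ n) (extinction_prob + (1 - extinction_prob) * exp (- y)) - extinction_prob \<le> (1 - extinction_prob) * contraction a (M ^ n) (exp (- y))"
        using bound[of "exp (- y)" n] y by simp
      also have "\<dots> \<le> contraction a (M ^ n) (exp (- y))"
        using contraction_bounds[of a "M ^ n" "exp (- y)"] a M y q
        by (intro mult_left_le_one_le) auto
      \<comment> \<open>The base \<open>1 + M ^ n * (exp (a * y) - 1)\<close> is at least
        \<open>M ^ n * (a * y)\<close>, and the exponent is negative.\<close>
      also have "\<dots> \<le> (a * (M / M') ^ n) powr (- 1 / a)"
      proof -
        have "a * y \<le> exp (a * y) - 1" using exp_ge_add_one_self[of "a * y"] by linarith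
        then have "M ^ n * (a * y) \<le> M ^ n * (exp (a * y) - 1)" using M by (intro mult_left_mono) auto
        moreover have "M ^ n * (a * y) = a * (M / M') ^ n" by (simp add: y_def power_divide)
        moreover have "exp (- y) powr (- a) = exp (a * y)" by (simp add: powr_def)
        ultimately show ?thesis
          unfolding contraction_def using a M M' by (intro powr_mono2') auto
      qed
      also have "\<dots> = a powr (- 1 / a) * ((M / M') powr (- 1 / a)) ^ n"
        using a M M' by (simp add: powr_mult powr_powr powr_realpow[symmetric] mult.commute)
      finally show "(gf ^^ n) (extinction_prob + (1 - extinction_prob) * exp (- y)) - extinction_prob \<le> a powr (- 1 / a) * ((M / M') powr (- 1 / a)) ^ n" .
    qed simp
    finally show ?thesis
      by (simp add: emeasure_eq_measure ennreal_mult[symmetric])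
  qed
  have "(M / M') powr (- 1 / a) < 1"
    using powr_less_mono2_neg[of "- 1 / a" 1 "M / M'"] a M M' by simp
  then have "summable (\<lambda>n. exp 1 * (a powr (- 1 / a) * ((M / M') powr (- 1 / a)) ^ n))"
    by (intro summable_mult summable_geometric) simp
  then have "summable (\<lambda>n. prob (bad n))"
    by (rule summable_comparison_test'[of _ 0]) (rule prob_bad)
  then have "AE k in gw_measure p. eventually (\<lambda>n. k \<in> space (gw_measure p) - bad n) sequentially"
    by (intro borel_cantelli_AE1 bad_sets) (auto simp: emeasure_eq_measure)
  then show ?thesis
    by eventually_elim (auto simp: bad_def elim: eventually_mono)
qed

end

subsection \<open>Dimensions of the boundary\<close>

lemma scale_level_bounds:
  assumes "0 < r" "r < 1"
  shows "- log 2 r \<le> scale_level r" "scale_level r < - log 2 r + 1"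
proof -
  have "log 2 r < 0" using assms by simp
  then have "scale_level r = real_of_int \<lceil>- log 2 r\<rceil>" by (simp add: scale_level_def)
  then show "- log 2 r \<le> scale_level r" "scale_level r < - log 2 r + 1" by linarith+
qed

lemma covering_number_gromov_boundary:
  assumes "r > 0" "E \<subseteq> gromov_boundary (tree_of k)"
  shows "Metric_space.covering_number (gromov_boundary (tree_of k)) boundary_dist r E
       = enat (card ((\<lambda>x. path_node x (scale_level r)) ` E))"
proof (rule covering_number_boundary[OF assms])
  show "finite ((\<lambda>x. path_node x (scale_level r)) ` E)"
    using path_nodes_subset_level[of "scale_level r" k] assms(2)
    by (intro finite_subset[OF _ finite_level[of "scale_level r" k]]) blast
qed

text \<open>The box count at scale \<open>r\<close> is the number \<open>P n\<close> of boundary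
  nodes at level \<open>n = scale_level r\<close>, squeezed between surviving and total generation
  sizes. The limit is that of \<open>ln (P n) / n\<close> times that of
  \<open>scale_level r / (- ln r)\<close>.\<close>

lemma box_dim_gromov_boundary:
  fixes m :: real
  assumes m: "m > 1"
    and lower: "\<And>M'::real. 1 < M' \<Longrightarrow> M' < m \<Longrightarrow> \<forall>\<^sub>F n in sequentially. surviving_size n k \<ge> M' ^ n"
    and upper: "\<And>\<delta>. \<delta> > 0 \<Longrightarrow> \<exists>C>0. \<forall>n. generation_size n k \<le> C * m powr ((1 + \<delta>) * n)"
  shows "Metric_space.box_dim (gromov_boundary (tree_of k)) boundary_dist = ereal (ln m / ln 2)"
proof -
  define F where "F = gromov_boundary (tree_of k)"
  interpret Metric_space F boundary_dist by (rule Metric_space_boundary)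
  define P where "P n = card ((\<lambda>x. path_node x n) ` F)" for n
  have P_ge: "surviving_size n k \<le> P n" for n
    unfolding P_def F_def by (rule surviving_size_le_card_path_nodes)
  have P_le: "P n \<le> generation_size n k" for n
    unfolding P_def F_def generation_size_eq_card by (rule card_mono[OF finite_level path_nodes_subset_level])
  have lnm: "ln m > 0" using m by simp
  have P_growth: "\<forall>\<^sub>F n in sequentially. exp (b * n) \<le> P n" if "0 < b" "b < ln m" for b :: real
  proof -
    have "exp b < m" using that m by (metis exp_less_cancel_iff exp_ln less_trans zero_less_one)
    then have "\<forall>\<^sub>F n in sequentially. surviving_size n k \<ge> exp b ^ n"
      using that by (intro lower) auto
    then show ?thesis
    proof eventually_elim
      case (elim n)
      have "exp (b * n) = exp b ^ n" by (simp add: exp_of_nat2_mult)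
      also have "\<dots> \<le> surviving_size n k" by (rule elim)
      also have "\<dots> \<le> P n" using P_ge by simp
      finally show ?case .
    qed
  qed
  have P_pos: "\<forall>\<^sub>F n in sequentially. P n > 0"
    using P_growth[of "ln m / 2"] lnm less_le_trans[OF exp_gt_zero]
    by (fastforce elim!: eventually_mono)
  have lim: "(\<lambda>n. ln (P n) / n) \<longlonglongrightarrow> ln m"
  proof (rule order_tendstoI)
    fix a assume "a < ln m"
    \<comment> \<open>The maximum with \<open>0\<close> is needed because \<open>a\<close> may be
      negative while \<open>P_growth\<close> asks for a positive rate.\<close>
    define b where "b = (max a 0 + ln m) / 2"
    have b: "0 < b" "b < ln m" "a < b" using \<open>a < ln m\<close> lnm by (auto simp: b_def max_def)
    show "\<forall>\<^sub>F n in sequentially. a < ln (P n) / n"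
      using P_growth[OF b(1,2)] eventually_gt_at_top[of 0]
    proof eventually_elim
      case (elim n)
      have "ln (exp (b * n)) \<le> ln (P n)" using elim by (intro ln_mono) auto
      then have "b \<le> ln (P n) / n" using elim by (simp add: pos_le_divide_eq)
      with b show ?case by simp
    qed
  next
    fix a assume a: "ln m < a"
    \<comment> \<open>Makes \<open>(1 + \<delta>) * ln m\<close> the midpoint of \<open>ln m\<close>
      and \<open>a\<close>; the remaining gap absorbs \<open>ln C\<close> for large
      \<open>n\<close>.\<close>
    define \<delta> where "\<delta> = (a / ln m - 1) / 2"
    have \<delta>: "\<delta> > 0" using a lnm by (simp add: \<delta>_def)
    obtain C where C: "C > 0" "\<And>n. generation_size n k \<le> C * m powr ((1 + \<delta>) * n)"
      using upper[OF \<delta>] by blast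
    have eq: "(1 + \<delta>) * ln m = (a + ln m) / 2" using lnm by (simp add: \<delta>_def field_simps)
    have "\<forall>\<^sub>F n in sequentially. n > nat \<lceil>ln C / ((a - ln m) / 2)\<rceil>"
      by (rule eventually_gt_at_top)
    then show "\<forall>\<^sub>F n in sequentially. ln (P n) / n < a"
      using P_pos eventually_gt_at_top[of 0]
    proof eventually_elim
      case (elim n)
      have "real (P n) \<le> C * m powr ((1 + \<delta>) * n)"
        using C(2)[of n] P_le[of n] by (meson of_nat_mono order_trans)
      then have "ln (P n) \<le> ln (C * m powr ((1 + \<delta>) * n))" using elim by (intro ln_mono) auto
      also have "\<dots> = ln C + n * ((a + ln m) / 2)"
        unfolding eq[symmetric] using C m by (simp add: ln_mult mult_ac)
      also have "ln C < n * ((a - ln m) / 2)"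
      proof -
        have "ln C / ((a - ln m) / 2) < n" using elim(1) by linarith
        then show ?thesis using a by (simp add: pos_divide_less_eq)
      qed
      also have "n * ((a - ln m) / 2) + n * ((a + ln m) / 2) = a * n" by (simp add: field_simps)
      finally show ?case using elim by (simp add: pos_divide_less_eq)
    qed
  qed
  have small: "\<forall>\<^sub>F r in at_right 0. 0 < r \<and> r < (1::real)"
    using eventually_at_right_real[of 0 1] by simp
  have ln_inf: "filterlim (\<lambda>r. - ln r) at_top (at_right (0::real))"
    using ln_at_0 by (simp add: filterlim_uminus_at_top)
  have log_eq: "- log 2 r = - ln r / ln 2" for r :: real by (simp add: log_def)
  have level_inf: "filterlim scale_level sequentially (at_right 0)"
  proof -
    have "filterlim (\<lambda>r. real (scale_level r)) at_top (at_right 0)"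
    proof (rule filterlim_at_top_mono[OF filterlim_at_top_mult_tendsto_pos[OF tendsto_const _ ln_inf]])
      show "0 < 1 / ln (2::real)" by simp
      show "\<forall>\<^sub>F r in at_right 0. - ln r * (1 / ln 2) \<le> real (scale_level r)"
        using small by eventually_elim (use scale_level_bounds(1) log_eq in auto)
    qed
    then show ?thesis using filterlim_sequentially_iff_filterlim_real by blast
  qed
  have ratio: "((\<lambda>r. scale_level r / (- ln r)) \<longlongrightarrow> 1 / ln 2) (at_right 0)"
  proof (rule tendsto_sandwich)
    show "\<forall>\<^sub>F r in at_right 0. 1 / ln 2 \<le> scale_level r / (- ln r)"
      using small
    proof eventually_elim
      case (elim r)
      then have "- ln r > 0" by simp
      then show ?case using scale_level_bounds(1)[of r] elim unfolding log_eq
        by (simp add: field_simps)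
    qed
    show "\<forall>\<^sub>F r in at_right 0. scale_level r / (- ln r) \<le> 1 / ln 2 + 1 / (- ln r)"
      using small
    proof eventually_elim
      case (elim r)
      then have *: "- ln r > 0" by simp
      have "scale_level r / (- ln r) \<le> (- ln r / ln 2 + 1) / (- ln r)"
        using scale_level_bounds(2)[of r] elim * unfolding log_eq by (intro divide_right_mono) auto
      also have "\<dots> = 1 / ln 2 + 1 / (- ln r)" using * by (simp add: field_simps)
      finally show ?case .
    qed
    show "((\<lambda>r. 1 / ln 2 + 1 / (- ln r)) \<longlongrightarrow> 1 / ln 2) (at_right (0::real))"
      using tendsto_add[OF tendsto_const[of "1 / ln 2"] tendsto_divide_0[OF tendsto_const[of 1] filterlim_at_top_imp_at_infinity[OF ln_inf]]]
      by simp
  qed simp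
  have "((\<lambda>r. ln (P (scale_level r)) / scale_level r * (scale_level r / (- ln r))) \<longlongrightarrow> ln m * (1 / ln 2)) (at_right 0)"
    by (intro tendsto_mult ratio filterlim_compose[OF lim level_inf])
  then have "((\<lambda>r. ereal (ln (P (scale_level r)) / scale_level r * (scale_level r / (- ln r)))) \<longlongrightarrow> ereal (ln m / ln 2)) (at_right 0)"
    by simp
  moreover have "\<forall>\<^sub>F r in at_right 0. ereal (ln (P (scale_level r)) / scale_level r * (scale_level r / (- ln r)))
     = ln_enat (covering_number r F) / ereal (- ln r)"
    using small eventually_compose_filterlim[OF P_pos level_inf]
      eventually_compose_filterlim[OF eventually_gt_at_top[of 0] level_inf]
  proof eventually_elim
    case (elim r)
    have "covering_number r F = enat (P (scale_level r))"
      unfolding P_def F_def by (rule covering_number_gromov_boundary) (use elim in auto)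
    then show ?case using elim by (simp add: ln_enat_def)
  qed
  ultimately have "((\<lambda>r. ln_enat (covering_number r F) / ereal (- ln r)) \<longlongrightarrow> ereal (ln m / ln 2)) (at_right 0)"
    by (rule Lim_transform_eventually)
  then show ?thesis
    unfolding F_def[symmetric] box_dim_def by (intro tendsto_Lim) auto
qed

text \<open>The deterministic half of the argument: the threshold on \<open>\<phi>\<close> shows
  that the node \<open>v\<close> under a ball is short enough, relative to the \<open>n\<close>
  levels to be covered, for \<open>bound\<close> to apply.\<close>

lemma generalised_assouad_spectrum_gromov_boundary_le:
  fixes m \<epsilon> \<epsilon>' :: real and N :: nat
  assumes m: "m > 1" and eps: "0 < \<epsilon>" "\<epsilon> < \<epsilon>'"
    and \<phi>_pos: "\<And>R. 0 < R \<Longrightarrow> R < 1 \<Longrightarrow> \<phi> R > 0"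
    and threshold: "\<forall>\<^sub>F x in at_right 0. \<phi> x > ln \<bar>ln x\<bar> / \<bar>ln x\<bar> * inverse (\<epsilon> * ln m)"
    and kN: "\<And>v. k v \<le> N"
    and bound: "\<And>A::nat. \<exists>C>0. \<forall>n v. real (length v) \<le> A * m powr (\<epsilon> * n) \<and> set v \<subseteq> {..<N}
       \<longrightarrow> generation_size n (\<lambda>u. k (v @ u)) \<le> C * m powr ((1 + \<epsilon>') * n)"
  shows "Metric_space.generalised_assouad_spectrum (gromov_boundary (tree_of k)) boundary_dist \<phi>
    \<le> ereal ((1 + \<epsilon>') * (ln m / ln 2))"
proof -
  define F where "F = gromov_boundary (tree_of k)"
  interpret Metric_space F boundary_dist by (rule Metric_space_boundary)
  define s where "s = (1 + \<epsilon>') * (ln m / ln 2)"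
  have lnm: "ln m > 0" using m by simp
  have s0: "s > 0" using eps lnm by (simp add: s_def)
  obtain x\<^sub>1 where x1: "x\<^sub>1 > 0" "\<And>x. 0 < x \<Longrightarrow> x < x\<^sub>1 \<Longrightarrow> \<phi> x > ln \<bar>ln x\<bar> / \<bar>ln x\<bar> * inverse (\<epsilon> * ln m)"
    using threshold unfolding eventually_at_right_field by auto
  \<comment> \<open>The cap \<open>exp (- 1)\<close> ensures \<open>- ln R \<ge> 1\<close> below
    \<open>x\<^sub>0\<close>, which resolves the absolute values and absorbs rounding.\<close>
  define x\<^sub>0 where "x\<^sub>0 = min x\<^sub>1 (exp (- 1))"
  have x0: "x\<^sub>0 > 0" "x\<^sub>0 \<le> x\<^sub>1" "x\<^sub>0 \<le> exp (- 1)" using x1 by (auto simp: x\<^sub>0_def)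
  \<comment> \<open>The first summand serves \<open>R < x\<^sub>0\<close>, the second the remaining
    radii, whose levels are at most \<open>scale_level x\<^sub>0\<close>.\<close>
  define A where "A = nat \<lceil>3 * m powr \<epsilon>\<rceil> + scale_level x\<^sub>0"
  have A: "3 * m powr \<epsilon> \<le> A" "scale_level x\<^sub>0 \<le> A"
    unfolding A_def by (auto simp: of_nat_ceiling add_increasing2)
  obtain C where C: "C > 0" "\<And>n v. real (length v) \<le> A * m powr (\<epsilon> * n) \<Longrightarrow> set v \<subseteq> {..<N}
       \<Longrightarrow> generation_size n (\<lambda>u. k (v @ u)) \<le> C * m powr ((1 + \<epsilon>') * n)"
    using bound[of A] by blast
  have cover: "(SUP x\<in>F. ereal_of_enat (covering_number r (mcball x R))) \<le> ereal (C * 2 powr s * (R / r) powr s)"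
    if R: "0 < R" "R < 1" and r: "r = R powr (1 + \<phi> R)" for R r
  proof -
    have \<phi>R: "\<phi> R > 0" using R \<phi>_pos by simp
    have r0: "0 < r" using R by (simp add: r)
    have rR: "r < R" using R \<phi>R powr_less_mono'[of R 1 "1 + \<phi> R"] by (simp add: r)
    then have r1: "r < 1" using R by simp
    have logr: "- log 2 r = (1 + \<phi> R) * - log 2 R" using R by (simp add: r log_powr)
    define j where "j = scale_level R"
    define l where "l = scale_level r"
    define n where "n = l - j"
    note jb = scale_level_bounds[OF R, folded j_def]
    note lb = scale_level_bounds[OF r0 r1, folded l_def]
    have jl: "j \<le> l"
    proof -
      have "- log 2 R \<le> - log 2 r" using R r0 rR by simp
      also have "\<dots> \<le> l" by (rule lb)
      finally show ?thesis unfolding j_def scale_level_le_iff .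
    qed
    then have l_eq: "l = j + n" by (simp add: n_def)
    have j_le: "real j \<le> A * m powr (\<epsilon> * n)"
    proof (cases "R < x\<^sub>0")
      case True
      have "ln R \<le> - 1" using ln_mono[of R "exp (- 1)"] True x0 R by simp
      then have abs: "\<bar>ln R\<bar> = - ln R" "- ln R \<ge> 1" by auto
      have *: "ln (- ln R) / (- ln R) * inverse (\<epsilon> * ln m) < \<phi> R"
        using x1(2)[of R] True x0 R by (simp add: abs(1))
      have "ln (- ln R) < \<phi> R * (- ln R) * (\<epsilon> * ln m)"
      proof -
        define w where "w = - ln R"
        have w: "w * (\<epsilon> * ln m) > 0" unfolding w_def using abs(2) eps lnm by (intro mult_pos_pos) auto
        have "ln w / w * inverse (\<epsilon> * ln m) * (w * (\<epsilon> * ln m)) < \<phi> R * (w * (\<epsilon> * ln m))"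
          using * w unfolding w_def by (intro mult_strict_right_mono)
        moreover have "ln w / w * inverse (\<epsilon> * ln m) * (w * (\<epsilon> * ln m)) = ln w"
          using w by (auto simp: divide_simps)
        ultimately show ?thesis by (simp add: w_def mult.assoc)
      qed
      \<comment> \<open>Here \<open>\<phi> R * - log 2 R\<close> is the exact level difference of
        the two scales; rounding \<open>j\<close> up costs the extra \<open>1\<close>, which later
        becomes the factor \<open>m powr \<epsilon>\<close>.\<close>
      also have "\<phi> R * (- ln R) \<le> (n + 1) * ln 2"
      proof -
        have "\<phi> R * - log 2 R \<le> n + 1" using lb(1) jb(2) unfolding logr l_eq by (simp add: algebra_simps)
        then show ?thesis by (simp add: log_def field_simps)
      qed
      also have "(n + 1) * ln 2 \<le> real (n + 1) * 1"
        using ln_2_less_1 by (intro mult_left_mono) auto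
      finally have "ln (- ln R) < (n + 1) * (\<epsilon> * ln m)"
        using eps lnm by (simp add: mult_right_mono)
      then have "exp (ln (- ln R)) \<le> exp ((n + 1) * (\<epsilon> * ln m))" by simp
      then have "- ln R \<le> exp ((n + 1) * (\<epsilon> * ln m))" using abs by simp
      also have "\<dots> = m powr \<epsilon> * m powr (\<epsilon> * n)"
        using m by (simp add: powr_def exp_add[symmetric] algebra_simps)
      finally have lnR: "- ln R \<le> m powr \<epsilon> * m powr (\<epsilon> * n)" .
      \<comment> \<open>The level \<open>j\<close> is at most \<open>- ln R / ln 2 + 1\<close>;
        since \<open>- ln R \<ge> 1\<close>, this is at most \<open>3 * (- ln R)\<close>, whence the
        \<open>3\<close> in \<open>A\<close>.\<close>
      have "1 / ln 2 \<le> (2::real)" using ln2_ge_two_thirds by (simp add: field_simps)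
      then have "- ln R * (1 / ln 2) \<le> - ln R * 2" using abs by (intro mult_left_mono) auto
      then have "real j \<le> 3 * (- ln R)" using jb(2) abs by (simp add: log_def)
      also have "\<dots> \<le> 3 * m powr \<epsilon> * m powr (\<epsilon> * n)" using lnR by simp
      also have "\<dots> \<le> A * m powr (\<epsilon> * n)" using A by (intro mult_right_mono) auto
      finally show ?thesis .
    next
      case False
      have "- log 2 R \<le> - log 2 x\<^sub>0" using False x0 R by simp
      also have "\<dots> \<le> scale_level x\<^sub>0"
        using scale_level_le_iff[of x\<^sub>0 "scale_level x\<^sub>0"] by simp
      finally have "j \<le> scale_level x\<^sub>0" unfolding j_def scale_level_le_iff .
      then have "real j \<le> real A * 1" using A by simp
      also have "\<dots> \<le> A * m powr (\<epsilon> * n)"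
        using m eps by (intro mult_left_mono ge_one_powr_ge_zero) auto
      finally show ?thesis .
    qed
    \<comment> \<open>Rounding \<open>l\<close> up gives \<open>n \<le> 1 + log 2 (R / r)\<close>;
      the \<open>1\<close> accounts for the factor \<open>2 powr s\<close>.\<close>
    have growth: "m powr ((1 + \<epsilon>') * n) \<le> 2 powr s * (R / r) powr s"
    proof -
      have "m powr ((1 + \<epsilon>') * n) = 2 powr (n * s)"
        using m by (simp add: s_def powr_def)
      also have "\<dots> \<le> 2 powr ((1 + log 2 (R / r)) * s)"
      proof -
        have "n \<le> 1 + log 2 (R / r)"
          using lb(2) jb(1) R r0 unfolding l_eq by (simp add: log_divide)
        then show ?thesis using s0 by simp
      qed
      also have "\<dots> = 2 powr s * (R / r) powr s"
        using R r0 by (simp add: distrib_right powr_add powr_powr[symmetric])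
      finally show ?thesis .
    qed
    show ?thesis
    proof (rule SUP_least)
      fix x assume x: "x \<in> F"
      define v where "v = path_node x j"
      have "v \<in> tree_of k" using x by (simp add: v_def F_def gromov_boundary_def)
      then have v: "set v \<subseteq> {..<N}"
        using kN by (auto simp: tree_of_def in_set_conv_nth) (meson less_le_trans)
      have ball: "mcball x R = {y \<in> F. path_node y j = v}"
        using x boundary_dist_le_iff[OF R(1)]
        by (auto simp: mcball_def v_def j_def)
      have "covering_number r (mcball x R) = enat (card ((\<lambda>y. path_node y l) ` mcball x R))"
        by (rule covering_number_gromov_boundary[OF r0, of _ k, folded F_def l_def]) (auto simp: mcball_def)
      moreover have "card ((\<lambda>y. path_node y l) ` mcball x R) \<le> generation_size n (\<lambda>u. k (v @ u))"
        unfolding ball l_eq unfolding F_def by (rule card_path_nodes_below_le)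
      moreover have "real (generation_size n (\<lambda>u. k (v @ u))) \<le> C * m powr ((1 + \<epsilon>') * n)"
        using j_le v by (intro C(2)) (simp_all add: v_def)
      moreover have "\<dots> \<le> C * (2 powr s * (R / r) powr s)" using C growth by (intro mult_left_mono) auto
      ultimately have "real (card ((\<lambda>y. path_node y l) ` mcball x R)) \<le> C * (2 powr s * (R / r) powr s)"
        by (meson of_nat_mono order_trans)
      with \<open>covering_number r (mcball x R) = _\<close>
      show "ereal_of_enat (covering_number r (mcball x R)) \<le> ereal (C * 2 powr s * (R / r) powr s)"
        by (simp add: mult.assoc)
    qed
  qed
  have "generalised_assouad_spectrum \<phi> \<le> ereal s"
    unfolding generalised_assouad_spectrum_def
  proof (rule Inf_lower, rule CollectI, rule exI[of _ s], intro conjI refl exI[of _ "C * 2 powr s"] ballI)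
    show "C * 2 powr s > 0" using C by simp
    fix R :: real assume "R \<in> {0<..<1}"
    then show "let r = R powr (1 + \<phi> R) in
        (SUP x\<in>F. ereal_of_enat (covering_number r (mcball x R))) \<le> ereal (C * 2 powr s * (R / r) powr s)"
      unfolding Let_def by (intro cover) auto
  qed
  then show ?thesis by (simp add: s_def F_def)
qed

section \<open>Almost sure dimension statements\<close>

context bounded_offspring
begin

text \<open>The growth bounds are monotone in \<open>M'\<close> and \<open>\<delta>\<close>, so
  rational \<open>M'\<close> and \<open>\<delta>\<close> of the form \<open>inverse (Suc i)\<close>
  suffice, and countably many null sets are discarded.\<close>

lemma AE_box_dim:
  "AE k in gw_measure p. infinite (tree_of k) \<longrightarrow>
     Metric_space.box_dim (gromov_boundary (tree_of k)) boundary_dist = ereal (ln m / ln 2)"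
proof -
  have "AE k in gw_measure p. \<forall>r::rat. 1 < real_of_rat r \<and> real_of_rat r < m \<longrightarrow> infinite (tree_of k)
     \<longrightarrow> (\<forall>\<^sub>F n in sequentially. real_of_rat r ^ n \<le> surviving_size n k)"
    unfolding AE_all_countable using AE_surviving_size_ge by (auto simp: AE_impI)
  \<comment> \<open>The bound is used only at the root \<open>v = []\<close>, whose length
    \<open>0\<close> is always admissible.\<close>
  moreover have "AE k in gw_measure p. \<forall>i::nat. \<exists>C>0. \<forall>n v. real (length v) \<le> 1 * m powr (inverse (Suc i) / 2 * n)
     \<and> set v \<subseteq> {..<N} \<longrightarrow> generation_size n (\<lambda>u. k (v @ u)) \<le> C * m powr ((1 + inverse (Suc i)) * n)"
    unfolding AE_all_countable by (intro allI AE_generation_size_bound) auto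
  ultimately show ?thesis
  proof eventually_elim
    case (elim k)
    show ?case
    proof (intro impI box_dim_gromov_boundary supercritical)
      assume inf: "infinite (tree_of k)"
      fix M' :: real assume M': "1 < M'" "M' < m"
      obtain r where r: "M' < real_of_rat r" "real_of_rat r < m" using of_rat_dense[OF M'(2)] by blast
      then have "1 < real_of_rat r" using M' by linarith
      with elim(1) inf r(2) have "\<forall>\<^sub>F n in sequentially. real_of_rat r ^ n \<le> surviving_size n k" by blast
      then show "\<forall>\<^sub>F n in sequentially. M' ^ n \<le> surviving_size n k"
      proof eventually_elim
        case (elim n)
        have "M' ^ n \<le> real_of_rat r ^ n" using r M' by (intro power_mono) auto
        with elim show ?case by linarith
      qed
    next
      fix \<delta> :: real assume "\<delta> > 0"
      then obtain i where i: "inverse (Suc i) < \<delta>" using reals_Archimedean by blast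
      obtain C where C: "C > 0" "\<And>n v. real (length v) \<le> m powr (inverse (Suc i) / 2 * n) \<Longrightarrow> set v \<subseteq> {..<N}
          \<Longrightarrow> generation_size n (\<lambda>u. k (v @ u)) \<le> C * m powr ((1 + inverse (Suc i)) * n)"
        using elim(2) by (metis mult_1)
      have "generation_size n k \<le> C * m powr ((1 + \<delta>) * n)" for n
      proof -
        have "generation_size n k \<le> C * m powr ((1 + inverse (Suc i)) * n)" using C(2)[of "[]" n] by simp
        also have "\<dots> \<le> C * m powr ((1 + \<delta>) * n)"
          using C(1) i supercritical by (intro mult_left_mono powr_mono mult_right_mono) auto
        finally show ?thesis .
      qed
      with C(1) show "\<exists>C>0. \<forall>n. generation_size n k \<le> C * m powr ((1 + \<delta>) * n)" by blast
    qed
  qed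
qed

text \<open>Since \<open>AE_generation_size_bound\<close> requires a strictly larger exponent, the
  estimate is first obtained for \<open>\<epsilon> + inverse (Suc i)\<close> outside one null set
  for all \<open>i\<close>; then \<open>i\<close> tends to infinity.\<close>

lemma AE_generalised_assouad_spectrum_le:
  assumes eps: "\<epsilon> > 0" and \<phi>_pos: "\<And>R. 0 < R \<Longrightarrow> R < 1 \<Longrightarrow> \<phi> R > 0"
    and threshold: "\<forall>\<^sub>F x in at_right 0. \<phi> x > ln \<bar>ln x\<bar> / \<bar>ln x\<bar> * inverse (\<epsilon> * ln m)"
  shows "AE k in gw_measure p.
     Metric_space.generalised_assouad_spectrum (gromov_boundary (tree_of k)) boundary_dist \<phi>
       \<le> ereal ((1 + \<epsilon>) * (ln m / ln 2))"
proof -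
  \<comment> \<open>The factor is \<open>Suc A\<close> because it must be positive.\<close>
  have "AE k in gw_measure p. \<forall>(i::nat) (A::nat). \<exists>C>0. \<forall>n v. real (length v) \<le> real (Suc A) * m powr (\<epsilon> * n)
     \<and> set v \<subseteq> {..<N} \<longrightarrow> generation_size n (\<lambda>u. k (v @ u)) \<le> C * m powr ((1 + (\<epsilon> + inverse (Suc i))) * n)"
    unfolding AE_all_countable using eps by (intro allI AE_generation_size_bound) auto
  then show ?thesis using AE_offspring_le
  proof eventually_elim
    case (elim k)
    define S where "S = Metric_space.generalised_assouad_spectrum (gromov_boundary (tree_of k)) boundary_dist \<phi>"
    have le: "S \<le> ereal ((1 + (\<epsilon> + inverse (Suc i))) * (ln m / ln 2))" for i
      unfolding S_def
    proof (rule generalised_assouad_spectrum_gromov_boundary_le[OF supercritical eps _ \<phi>_pos threshold])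
      show "\<epsilon> < \<epsilon> + inverse (Suc i)" by simp
      show "k v \<le> N" for v using elim(2) by blast
      fix A :: nat
      obtain C where C: "C > 0" "\<And>n v. real (length v) \<le> real (Suc A) * m powr (\<epsilon> * n) \<Longrightarrow> set v \<subseteq> {..<N}
          \<Longrightarrow> generation_size n (\<lambda>u. k (v @ u)) \<le> C * m powr ((1 + (\<epsilon> + inverse (Suc i))) * n)"
        using elim(1) by meson
      have "real A * m powr (\<epsilon> * n) \<le> real (Suc A) * m powr (\<epsilon> * n)" for n :: nat
        by (intro mult_right_mono) auto
      with C show "\<exists>C>0. \<forall>n v. real (length v) \<le> real A * m powr (\<epsilon> * n) \<and> set v \<subseteq> {..<N}
          \<longrightarrow> generation_size n (\<lambda>u. k (v @ u)) \<le> C * m powr ((1 + (\<epsilon> + inverse (Suc i))) * n)"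
        by (meson order_trans)
    qed
    have lim: "(\<lambda>i. ereal ((1 + (\<epsilon> + inverse (Suc i))) * (ln m / ln 2))) \<longlonglongrightarrow> ereal ((1 + (\<epsilon> + 0)) * (ln m / ln 2))"
      by (intro tendsto_intros LIMSEQ_inverse_real_of_nat)
    have "S \<le> ereal ((1 + (\<epsilon> + 0)) * (ln m / ln 2))"
      by (rule LIMSEQ_le_const[OF lim]) (use le in blast)
    then show ?case by (simp add: S_def)
  qed
qed

end

theorem theorem2p1:
  fixes M :: "'w measure" and K :: "nat list \<Rightarrow> 'w \<Rightarrow> nat" and p :: "nat pmf"
    and N :: nat and m \<epsilon> :: real and \<phi> :: "real \<Rightarrow> real" and F :: "'w \<Rightarrow> (nat \<Rightarrow> nat) set"
  assumes gw: "galton_watson p M K"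
    and bounded_offspring: "set_pmf p \<subseteq> {0..N}"
    and mean: "m = measure_pmf.expectation p real"
    and supercritical: "m > 1"
    and eps: "\<epsilon> > 0"
    and dimfun: "dimension_function \<phi>"
    and threshold: "\<forall>\<^sub>F x in at_right 0. \<phi> x > ln \<bar>ln x\<bar> / \<bar>ln x\<bar> * inverse (\<epsilon> * ln m)"
    and boundary: "\<And>\<omega>. F \<omega> = gromov_boundary (gw_tree K \<omega>)"
  shows "AE \<omega> in uniform_measure M {\<omega> \<in> space M. infinite (gw_tree K \<omega>)}.
    Metric_space.generalised_assouad_spectrum (F \<omega>) boundary_dist \<phi>
      \<le> ereal (1 + \<epsilon>) * Metric_space.box_dim (F \<omega>) boundary_dist"
proof -
  interpret bounded_offspring p N m by standard fact+
  note K = distr_galton_watson[OF gw]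
  have "AE k in gw_measure p.
     Metric_space.generalised_assouad_spectrum (gromov_boundary (tree_of k)) boundary_dist \<phi>
       \<le> ereal ((1 + \<epsilon>) * (ln m / ln 2))"
    by (rule AE_generalised_assouad_spectrum_le[OF eps _ threshold])
      (use dimfun in \<open>auto simp: dimension_function_def\<close>)
  with AE_box_dim have "AE k in gw_measure p. infinite (tree_of k) \<longrightarrow>
     Metric_space.generalised_assouad_spectrum (gromov_boundary (tree_of k)) boundary_dist \<phi>
       \<le> ereal (1 + \<epsilon>) * Metric_space.box_dim (gromov_boundary (tree_of k)) boundary_dist"
    by eventually_elim simp
  \<comment> \<open>The family \<open>K\<close> has law \<open>gw_measure p\<close>, so the almost
    sure statement pulls back to \<open>M\<close>; conditioning on the measurable survival event
    then removes the implication.\<close>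
  then have ae: "AE \<omega> in M. infinite (gw_tree K \<omega>) \<longrightarrow>
     Metric_space.generalised_assouad_spectrum (F \<omega>) boundary_dist \<phi>
       \<le> ereal (1 + \<epsilon>) * Metric_space.box_dim (F \<omega>) boundary_dist"
    unfolding boundary gw_tree_def by (intro AE_distrD[OF K(1)]) (simp only: K(2))
  have eq: "(\<lambda>\<omega> v. K v \<omega>) -` {k. infinite (tree_of k)} \<inter> space M
      = {\<omega> \<in> space M. infinite (gw_tree K \<omega>)}"
    by (auto simp: gw_tree_def)
  have "{\<omega> \<in> space M. infinite (gw_tree K \<omega>)} \<in> sets M"
    using measurable_sets[OF K(1) sets_infinite_tree] unfolding eq .
  then show ?thesis
    by (rule AE_uniform_measureI) (use ae in \<open>eventually_elim, simp\<close>)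
qed

end
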